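(* There exists a universal constant $c>0$ such that the following holds. Let $n\geq 1$ and let $X\sim\mu$ be a centered random vector in $\mathbf{R}^n$ such that \[ C_{\rm KL}(\mu)=\sup_{\substack{\theta,\eta\in\mathbf{R}^n\\ \theta\neq\eta}}\frac{\mathrm{KL}(\mu_\theta\,\|\,\mu_\eta)}{\|\theta-\eta\|_2^2}<\infty, \] where $\mu_\theta$ denotes the law of the translate $\theta+X$. Then, for every nonempty, bounded set $T\subset\mathbf{R}^n$, \[ \mathbf{E}_{X\sim\mu}\Big[\sup_{t\in T}\langle X,t\rangle\Big]\;\geq\;\frac{c}{\sqrt{C_{\rm KL}(\mu)}}\,\gamma_2(T). \]
   Context: Centered means that $X$ is integrable with $\mathbf{E}X=0$. For probability measures $P,Q$, the Kullback-Leibler divergence is $\mathrm{KL}(P\,\|\,Q)=\int\log\frac{\mathrm{d}P}{\mathrm{d}Q}\,\mathrm{d}P$ if $P\ll Q$ and $+\infty$ otherwise ($\log$ is the natural logarithm). $\langle\cdot,\cdot\rangle$ and $\|\cdot\|_2$ are the Euclidean inner product and norm on $\mathbf{R}^n$. Talagrand's generic chaining functional of a metric space $(T,d)$ is \[ \gamma_2(T,d)=\inf\,\sup_{t\in T}\sum_{k=0}^\infty 2^{k/2}\,\mathrm{diam}(A_k(t)), \] where the infimum ranges over admissible sequences, i.e. increasing sequences of partitions $\{\mathcal{A}_k\}_{k\geq0}$ of $T$ (each $\mathcal{A}_{k+1}$ refines $\mathcal{A}_k$) such that $|\mathcal{A}_0|=1$ and $|\mathcal{A}_k|\leq 2^{2^k}$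 for $k\geq1$, and $A_k(t)$ denotes the element of $\mathcal{A}_k$ containing $t$. For $T\subset\mathbf{R}^n$, $\gamma_2(T)$ denotes $\gamma_2(T,d)$ with $d(t,s)=\|t-s\|_2$. "Universal" means that $c$ does not depend on $n$, $\mu$, or $T$. *)

theory Defs
  imports "HOL-Probability.Probability"
begin

(* The dimension n is quantified inside the theorem (the constant must not depend on it), so
   R^n is modelled as the finite product of n copies of the Borel line; a vector is a function
   that is extensional on {..<n}. *)

abbreviation borel_Rn :: "nat \<Rightarrow> (nat \<Rightarrow> real) measure" where
  "borel_Rn n \<equiv> Pi\<^sub>M {..<n} (\<lambda>_. borel)"

abbreviation Rn :: "nat \<Rightarrow> (nat \<Rightarrow> real) set" where
  "Rn n \<equiv> {..<n} \<rightarrow>\<^sub>E UNIV"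

definition ip :: "nat \<Rightarrow> (nat \<Rightarrow> real) \<Rightarrow> (nat \<Rightarrow> real) \<Rightarrow> real" where
  "ip n x y = (\<Sum>i<n. x i * y i)"

definition nrm :: "nat \<Rightarrow> (nat \<Rightarrow> real) \<Rightarrow> real" where
  "nrm n x = L2_set x {..<n}"

definition edist :: "nat \<Rightarrow> (nat \<Rightarrow> real) \<Rightarrow> (nat \<Rightarrow> real) \<Rightarrow> real" where
  "edist n x y = nrm n (\<lambda>i. x i - y i)"

definition centered :: "nat \<Rightarrow> (nat \<Rightarrow> real) measure \<Rightarrow> bool" where
  "centered n \<mu> \<longleftrightarrow>
     (\<forall>i<n. integrable \<mu> (\<lambda>x. x i) \<and> (\<integral>x. x i \<partial>\<mu>) = 0)"

definition translate :: "nat \<Rightarrow> (nat \<Rightarrow> real) measure \<Rightarrow> (nat \<Rightarrow> real) \<Rightarrow> (nat \<Rightarrow> real) measure" where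
  "translate n \<mu> \<theta> = distr \<mu> (borel_Rn n) (\<lambda>x. \<lambda>i\<in>{..<n}. \<theta> i + x i)"

(* The library's KL_divergence b Q P is the real-valued Bochner integral of log b (dP/dQ)
   against P (mind the argument order), hence 0 when the log-density is not integrable. For
   probability measures the negative part of the log-density is always P-integrable (lemma
   KL_negative_part_finite), so non-integrability means exactly that the integral is infinite. *)
definition KL :: "'a measure \<Rightarrow> 'a measure \<Rightarrow> ereal" where
  "KL P Q = (if absolutely_continuous Q P \<and> integrable P (entropy_density (exp 1) Q P)
             then ereal (KL_divergence (exp 1) Q P) else \<infinity>)"

lemma KL_negative_part_finite:
  assumes "prob_space P" "prob_space Q" "absolutely_continuous Q P" "sets P = sets Q"
  shows "(\<integral>\<^sup>+x. ennreal (- entropy_density (exp 1) Q P x) \<partial>P) \<le> 1"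
proof -
  interpret P: prob_space P by fact
  interpret Q: prob_space Q by fact
  let ?f = "RN_deriv Q P"
  have dens: "density Q ?f = P"
    using assms by (intro Q.density_RN_deriv) auto
  have pw: "r * ennreal (- log (exp 1) (enn2real r)) \<le> 1" for r :: ennreal
  proof (cases r)
    case (real y)
    show ?thesis
    proof (cases "0 < y")
      case True
      have "y * (- ln y) \<le> 1"
      proof -
        have "ln (1 / y) \<le> 1 / y - 1" using True by (intro ln_le_minus_one) auto
        hence "y * (- ln y) \<le> y * (1 / y - 1)" 
          using True by (intro mult_left_mono) (auto simp: ln_div)
        also have "\<dots> = 1 - y" using True by (simp add: field_simps)
        finally show ?thesis using True by simp
      qed
      moreover have "log (exp 1) y = ln y" by (simp add: log_def)
      ultimately show ?thesis using real True
        by (simp add: ennreal_mult'[symmetric] ennreal_le_1)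
    qed (use real in auto)
  qed (auto simp: log_def)
  have "(\<integral>\<^sup>+x. ennreal (- entropy_density (exp 1) Q P x) \<partial>P) =
        (\<integral>\<^sup>+x. ?f x * ennreal (- entropy_density (exp 1) Q P x) \<partial>Q)"
    by (subst (1) dens[symmetric], subst nn_integral_density) auto
  also have "\<dots> \<le> (\<integral>\<^sup>+x. 1 \<partial>Q)"
    by (intro nn_integral_mono) (use pw in \<open>auto simp: entropy_density_def\<close>)
  finally show ?thesis by (simp add: Q.emeasure_space_1)
qed

definition CKL :: "nat \<Rightarrow> (nat \<Rightarrow> real) measure \<Rightarrow> ereal" where
  "CKL n \<mu> = (SUP (\<theta>, \<eta>) \<in> {(\<theta>, \<eta>). \<theta> \<in> Rn n \<and> \<eta> \<in> Rn n \<and> \<theta> \<noteq> \<eta>}.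
      KL (translate n \<mu> \<theta>) (translate n \<mu> \<eta>) / ereal ((edist n \<theta> \<eta>)\<^sup>2))"

definition diam :: "('a \<Rightarrow> 'a \<Rightarrow> real) \<Rightarrow> 'a set \<Rightarrow> ennreal" where
  "diam d A = (SUP (x, y) \<in> A \<times> A. ennreal (d x y))"

definition admissible :: "'a set \<Rightarrow> (nat \<Rightarrow> 'a set set) \<Rightarrow> bool" where
  "admissible T \<A> \<longleftrightarrow>
     (\<forall>k. partition_on T (\<A> k)) \<and>
     (\<forall>k. refines T (\<A> (Suc k)) (\<A> k)) \<and>
     card (\<A> 0) = 1 \<and>
     (\<forall>k\<ge>1. finite (\<A> k) \<and> card (\<A> k) \<le> 2 ^ (2 ^ k))"

definition part_of :: "'a set set \<Rightarrow> 'a \<Rightarrow> 'a set" where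
  "part_of P t = (THE A. A \<in> P \<and> t \<in> A)"

definition gamma2 :: "'a set \<Rightarrow> ('a \<Rightarrow> 'a \<Rightarrow> real) \<Rightarrow> ennreal" where
  "gamma2 T d = (INF \<A> \<in> {\<A>. admissible T \<A>}. SUP t\<in>T.
      (\<Sum>k. ennreal (2 powr (real k / 2)) * diam d (part_of (\<A> k) t)))"

end

theory Submission
  imports Defs
begin

text \<open>
  The heart of the proof is a multi-scale Sudakov inequality for the functional
  \<open>width A = E (SUP t\<in>A. \<langle>X, t\<rangle>)\<close>. Hide an index \<open>L\<close>, uniform on a finite separated set \<open>I\<close>, in the
  observation \<open>Y = X + l L\<close>, and let \<open>L'\<close> be a fresh sample from the posterior of \<open>L\<close> given \<open>Y\<close>.
  Then \<open>(L', Y)\<close> has the law of \<open>(L, Y)\<close>, so that the supremum over the piece \<open>H L'\<close> of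
  \<open>\<langle>X, t\<rangle> = \<langle>Y - l L', t\<rangle> + l \<langle>L' - L, t\<rangle>\<close> has expectation at least the average of \<open>width (H u)\<close>
  plus, by exchangeability of \<open>L\<close> and \<open>L'\<close>, about half of \<open>l E \<parallel>L - L'\<parallel>\<^sup>2\<close>. The bound on the
  Kullback-Leibler divergences of the translates forces \<open>L \<noteq> L'\<close> with probability at least \<open>1/4\<close>
  (Fano's inequality), as long as \<open>l\<close> is of order \<open>sqrt (ln (card I) / C)\<close> over the diameter of \<open>I\<close>.

  This growth condition bounds \<open>gamma2\<close> by van Handel's interpolation argument: with \<open>s\<^sub>k(x)\<close> a
  minimiser of \<open>s \<mapsto> t\<^sub>k s - width (T \<inter> B(x, s))\<close>, \<open>t\<^sub>k\<close> proportional to \<open>2 powr (k/2)\<close>, the sums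
  \<open>\<Sum>\<^sub>k t\<^sub>k s\<^sub>k(x)\<close> telescope to at most a multiple of \<open>width T\<close>, while the growth condition shows that the part
  of a cell where \<open>s\<^sub>k\<close> is small compared to the diameter is covered by few sets of much smaller diameter.
\<close>

section \<open>Generic chaining from a growth condition\<close>

lemma fibre_partition_on: "partition_on A ((\<lambda>c. {x \<in> A. g x = c}) ` g ` A)"
  by (auto simp: partition_on_def disjoint_def)

lemma part_of_eq:
  assumes "partition_on T P" "A \<in> P" "t \<in> A"
  shows "part_of P t = A"
  unfolding part_of_def
proof (rule the_equality)
  fix B assume "B \<in> P \<and> t \<in> B"
  thus "B = A" using assms by (auto simp: partition_on_def disjoint_def)
qed (use assms in auto)

lemma partition_on_UN_split:
  assumes "partition_on T P" "\<And>A. A \<in> P \<Longrightarrow> partition_on A (f A)"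
  shows "partition_on T (\<Union>A\<in>P. f A)"
proof (rule partition_onI)
  have sub: "B \<subseteq> A" if "B \<in> f A" "A \<in> P" for A B
    using that assms(2)[of A] by (auto simp: partition_on_def)
  show "\<Union> (\<Union>A\<in>P. f A) = T"
    using assms(2) partition_onD1[OF assms(1)] by (fastforce simp: partition_on_def)
  show "disjnt p q" if "p \<in> (\<Union>A\<in>P. f A)" "q \<in> (\<Union>A\<in>P. f A)" "p \<noteq> q" for p q
  proof -
    obtain A B where AB: "A \<in> P" "p \<in> f A" "B \<in> P" "q \<in> f B" using \<open>p \<in> _\<close> \<open>q \<in> _\<close> by blast
    show ?thesis
    proof (cases "A = B")
      case True
      thus ?thesis using AB assms(2)[OF AB(1)] \<open>p \<noteq> q\<close> by (auto simp: partition_on_def disjoint_def disjnt_def)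
    next
      case False
      hence "disjnt A B" using AB assms(1) by (auto simp: partition_on_def disjoint_def disjnt_def)
      thus ?thesis using sub AB by (meson disjnt_subset1 disjnt_subset2)
    qed
  qed
  show "{} \<notin> (\<Union>A\<in>P. f A)"
    using assms(2) by (auto simp: partition_on_def)
qed

text \<open>Since \<open>m\<close> bounds the size of every separated set, one of largest
  cardinality exists; by maximality it is an \<open>\<epsilon>\<close>-net of
  \<open>B\<close>.\<close>

lemma separated_set_or_cover:
  fixes d :: "'a \<Rightarrow> 'a \<Rightarrow> real"
  assumes no_sep: "\<And>I. I \<subseteq> B \<Longrightarrow> finite I \<Longrightarrow> card I = Suc m \<Longrightarrow> \<not> (\<forall>u\<in>I. \<forall>v\<in>I. u \<noteq> v \<longrightarrow> \<epsilon> \<le> d u v)"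
    and sym: "\<And>x y. x \<in> B \<Longrightarrow> y \<in> B \<Longrightarrow> d x y = d y x"
    and refl: "\<And>x. x \<in> B \<Longrightarrow> d x x < \<epsilon>"
  obtains J where "finite J" "J \<subseteq> B" "card J \<le> m" "\<And>x. x \<in> B \<Longrightarrow> \<exists>c\<in>J. d x c < \<epsilon>"
proof -
  define sep where "sep I \<longleftrightarrow> I \<subseteq> B \<and> finite I \<and> (\<forall>u\<in>I. \<forall>v\<in>I. u \<noteq> v \<longrightarrow> \<epsilon> \<le> d u v)" for I
  have card_le: "card I \<le> m" if "sep I" for I
  proof (rule ccontr)
    assume "\<not> card I \<le> m"
    hence "Suc m \<le> card I" by simp
    then obtain I' where I': "I' \<subseteq> I" "card I' = Suc m" "finite I'"
      by (rule obtain_subset_with_card_n)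
    have "\<not> (\<forall>u\<in>I'. \<forall>v\<in>I'. u \<noteq> v \<longrightarrow> \<epsilon> \<le> d u v)"
      using that I' by (intro no_sep) (auto simp: sep_def)
    thus False using that I'(1) by (auto simp: sep_def)
  qed
  have "sep {}" by (simp add: sep_def)
  then obtain J where J: "sep J" "\<And>I. sep I \<Longrightarrow> card I \<le> card J"
    using ex_has_greatest_nat[of sep "{}" card "Suc m"] card_le by (auto simp: less_Suc_eq_le)
  have "\<exists>c\<in>J. d x c < \<epsilon>" if x: "x \<in> B" for x
  proof (rule ccontr)
    assume neg: "\<not> (\<exists>c\<in>J. d x c < \<epsilon>)"
    have "x \<notin> J" using neg refl x by auto
    moreover have "sep (insert x J)"
      using neg J(1) x sym unfolding sep_def by (auto simp: not_less subset_eq)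
    ultimately show False using J(2)[of "insert x J"] J(1) by (auto simp: sep_def)
  qed
  thus ?thesis using that J(1) card_le[OF J(1)] unfolding sep_def by blast
qed

lemma sum_inverse_sqrt2_le: "(\<Sum>k\<le>n. 2 powr (- real k / 2)) \<le> 4"
proof -
  let ?q = "2 powr (-1/2) :: real"
  have q: "?q = sqrt 2 / 2"
    by (simp add: powr_minus powr_half_sqrt field_simps)
  have "sqrt 2 \<le> 3 / 2" by (rule real_le_lsqrt) (auto simp: power2_eq_square)
  hence q34: "?q \<le> 3/4" unfolding q by simp
  have pw: "2 powr (- real k / 2) = ?q ^ k" for k
    by (simp add: powr_powr flip: powr_realpow)
  have "(\<Sum>k\<le>n. ?q ^ k) \<le> 1 / (1 - ?q)"
    using q34 by (intro order.trans[OF sum_le_suminf[OF summable_geometric]]) (auto simp: suminf_geometric)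
  also have "\<dots> \<le> 4" using q34 by (simp add: field_simps)
  finally show ?thesis by (simp only: pw)
qed

section \<open>Functionals with a growth condition\<close>

text \<open>The assumption \<open>growth\<close> is the multi-scale Sudakov inequality. For
  \<open>\<epsilon>\<close> comparable to \<open>R\<close> the gain is of order
  \<open>R * sqrt (ln (card I))\<close>, as in Sudakov minoration, while the pieces
  \<open>H u\<close> may have radius a fixed fraction of \<open>R\<close>.\<close>

locale growth_functional =
  fixes T :: "'a set" and d :: "'a \<Rightarrow> 'a \<Rightarrow> real" and G :: "'a set \<Rightarrow> real" and \<kappa> D :: real
  assumes T_ne: "T \<noteq> {}"
    and d_nonneg: "\<And>x y. x \<in> T \<Longrightarrow> y \<in> T \<Longrightarrow> 0 \<le> d x y"
    and d_refl: "\<And>x. x \<in> T \<Longrightarrow> d x x = 0"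
    and d_sym: "\<And>x y. x \<in> T \<Longrightarrow> y \<in> T \<Longrightarrow> d x y = d y x"
    and d_tri: "\<And>x y z. x \<in> T \<Longrightarrow> y \<in> T \<Longrightarrow> z \<in> T \<Longrightarrow> d x z \<le> d x y + d y z"
    and d_le: "\<And>x y. x \<in> T \<Longrightarrow> y \<in> T \<Longrightarrow> d x y \<le> D"
    and G_nonneg: "\<And>A. A \<noteq> {} \<Longrightarrow> A \<subseteq> T \<Longrightarrow> 0 \<le> G A"
    and G_mono: "\<And>A B. A \<noteq> {} \<Longrightarrow> A \<subseteq> B \<Longrightarrow> B \<subseteq> T \<Longrightarrow> G A \<le> G B"
    and kappa_pos: "0 < \<kappa>"
    and growth: "\<And>I H s R \<epsilon> h. \<lbrakk>finite I; I \<subseteq> T; 2 \<le> card I; s \<in> T; 0 < R; 0 < \<epsilon>;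
        \<And>u. u \<in> I \<Longrightarrow> d u s \<le> R;
        \<And>u v. u \<in> I \<Longrightarrow> v \<in> I \<Longrightarrow> u \<noteq> v \<Longrightarrow> \<epsilon> \<le> d u v;
        \<And>u. u \<in> I \<Longrightarrow> H u \<noteq> {}; \<And>u. u \<in> I \<Longrightarrow> H u \<subseteq> T;
        \<And>u v. u \<in> I \<Longrightarrow> v \<in> H u \<Longrightarrow> d v u \<le> h;
        h * R \<le> \<epsilon>\<^sup>2 / 32\<rbrakk> \<Longrightarrow>
        \<exists>u\<in>I. G (H u) + \<kappa> * sqrt (ln (real (card I))) * \<epsilon>\<^sup>2 / R \<le> G (\<Union>u\<in>I. H u)"
begin

text \<open>For \<open>N = 2 ^ (2 ^ k)\<close> points the factor
  \<open>\<kappa> * sqrt (ln N)\<close> equals \<open>growth_const * 2 powr (k / 2)\<close>, the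
  chaining weight of level \<open>k\<close> up to a constant.\<close>

definition growth_const :: real where "growth_const = \<kappa> * sqrt (ln 2)"

lemma growth_const_pos: "0 < growth_const" using kappa_pos by (simp add: growth_const_def)

text \<open>A real-valued companion of \<open>diam\<close>, so that the recursion for diameters runs
  in real arithmetic; \<open>D\<close> keeps the suprema finite.\<close>

definition rdiam :: "'a set \<Rightarrow> real" where "rdiam A = (SUP p\<in>A \<times> A. d (fst p) (snd p))"

lemma bdd_rdiam: "A \<subseteq> T \<Longrightarrow> bdd_above ((\<lambda>p. d (fst p) (snd p)) ` (A \<times> A))"
  by (rule bdd_aboveI[of _ D]) (force intro!: d_le)

lemma rdiam_ge: "A \<subseteq> T \<Longrightarrow> x \<in> A \<Longrightarrow> y \<in> A \<Longrightarrow> d x y \<le> rdiam A"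
  unfolding rdiam_def using cSUP_upper[OF _ bdd_rdiam, of "(x, y)" A] by auto

lemma rdiam_le: "A \<noteq> {} \<Longrightarrow> (\<And>x y. x \<in> A \<Longrightarrow> y \<in> A \<Longrightarrow> d x y \<le> R) \<Longrightarrow> rdiam A \<le> R"
  unfolding rdiam_def by (intro cSUP_least) auto

lemma rdiam_nonneg: "A \<noteq> {} \<Longrightarrow> A \<subseteq> T \<Longrightarrow> 0 \<le> rdiam A"
  using rdiam_ge d_refl by (metis ex_in_conv subsetD)

lemma rdiam_mono: "A \<noteq> {} \<Longrightarrow> A \<subseteq> B \<Longrightarrow> B \<subseteq> T \<Longrightarrow> rdiam A \<le> rdiam B"
  by (intro rdiam_le rdiam_ge) auto

lemma diam_le_rdiam: "A \<subseteq> T \<Longrightarrow> diam d A \<le> ennreal (rdiam A)"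
  unfolding diam_def by (intro SUP_least) (auto intro!: ennreal_leI rdiam_ge)

text \<open>Growth is applied to two points \<open>x\<close> and \<open>y\<close> with singleton
  pieces, \<open>R = \<epsilon> = d x y\<close> and \<open>h = 0\<close>. This controls the first
  term of the chaining sum.\<close>

lemma growth_const_rdiam_le: "growth_const * rdiam T \<le> G T"
proof -
  have "d x y \<le> G T / growth_const" if x: "x \<in> T" and y: "y \<in> T" for x y
  proof (cases "d x y = 0")
    case True
    thus ?thesis using G_nonneg[of T] T_ne growth_const_pos by simp
  next
    case False
    hence pos: "0 < d x y" and ne: "x \<noteq> y" using d_nonneg[OF x y] d_refl[OF x] by auto
    have "\<exists>u\<in>{x,y}. G {u} + \<kappa> * sqrt (ln (real (card {x,y}))) * (d x y)\<^sup>2 / d x y \<le> G (\<Union>u\<in>{x,y}. {u})"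
      by (rule growth[of "{x,y}" x "d x y" "d x y" "\<lambda>u. {u}" 0])
         (use x y pos ne d_sym[OF x y] d_refl[OF x] d_refl[OF y] in auto)
    then obtain u where u: "u \<in> {x,y}" 
      "G {u} + \<kappa> * sqrt (ln (real (card {x,y}))) * (d x y)\<^sup>2 / d x y \<le> G (\<Union>u\<in>{x,y}. {u})" by blast
    have "0 \<le> G {u}" using u(1) x y by (intro G_nonneg) auto
    moreover have "G (\<Union>u\<in>{x,y}. {u}) \<le> G T" using x y by (intro G_mono) auto
    ultimately have "growth_const * d x y \<le> G T" using u(2) ne pos by (simp add: growth_const_def power2_eq_square)
    thus ?thesis using growth_const_pos by (simp add: field_simps)
  qed
  hence "rdiam T \<le> G T / growth_const" using T_ne by (intro rdiam_le)
  thus ?thesis using growth_const_pos by (simp add: field_simps)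
qed

section \<open>Near-minimal ball radii\<close>

definition ball_G :: "'a \<Rightarrow> real \<Rightarrow> real" where "ball_G x s = G {y \<in> T. d y x \<le> s}"

lemma ball_G_bounds: 
  assumes "x \<in> T" "0 \<le> s" shows "0 \<le> ball_G x s" "ball_G x s \<le> G T"
  using assms d_refl[of x] unfolding ball_G_def by (intro G_nonneg G_mono; auto)+

text \<open>The infimum of \<open>t * s - ball_G x s\<close> over \<open>s \<ge> 0\<close> may not
  be attained, hence the additive error \<open>\<delta>\<close>.\<close>

definition near_min :: "real \<Rightarrow> real \<Rightarrow> 'a \<Rightarrow> real \<Rightarrow> bool" where
  "near_min t \<delta> x s \<longleftrightarrow> 0 \<le> s \<and> (\<forall>s'\<ge>0. t * s - ball_G x s \<le> t * s' - ball_G x s' + \<delta>)"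

lemma near_min_exists:
  assumes "x \<in> T" "0 \<le> t" "0 < \<delta>"
  shows "\<exists>s. near_min t \<delta> x s"
proof -
  let ?v = "\<lambda>s. t * s - ball_G x s"
  have "- G T \<le> ?v s" if "0 \<le> s" for s
    using ball_G_bounds(2)[OF assms(1) that] assms(2) that mult_nonneg_nonneg[of t s] by linarith
  hence bdd: "bdd_below (?v ` {0..})" by (intro bdd_belowI[of _ "- G T"]) auto
  have "Inf (?v ` {0..}) < Inf (?v ` {0..}) + \<delta>" using assms by simp
  from cInf_lessD[OF _ this] obtain s where "0 \<le> s" "?v s < Inf (?v ` {0..}) + \<delta>" by auto
  moreover have "Inf (?v ` {0..}) \<le> ?v s'" if "0 \<le> s'" for s'
    using that by (intro cInf_lower bdd) auto
  ultimately show ?thesis unfolding near_min_def by (intro exI[of _ s]) force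
qed

context
  fixes \<delta> :: real
  assumes delta_pos: "0 < \<delta>"
begin

text \<open>The factor \<open>1 / 256\<close> makes the cost \<open>price k * (2 * R)\<close> half
  of the gain \<open>growth_const * 2 powr (k / 2) * (R / 8)\<^sup>2 / R\<close> of an
  \<open>R / 8\<close>-separated set. Separation is raised by \<open>mesh k\<close> to pay for
  \<open>slack k\<close>, and the decay of \<open>mesh\<close> keeps all errors together of order
  \<open>\<delta>\<close>.\<close>

definition price :: "nat \<Rightarrow> real" where "price k = growth_const * 2 powr (real k / 2) / 256"
definition mesh :: "nat \<Rightarrow> real" where "mesh k = \<delta> * 2 powr (- real k)"
definition slack :: "nat \<Rightarrow> real" where "slack k = growth_const * 2 powr (real k / 2) * mesh k / 4"
definition opt_radius :: "nat \<Rightarrow> 'a \<Rightarrow> real" where "opt_radius k x = (SOME s. near_min (price k) (slack k) x s)"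

lemma mesh_pos: "0 < mesh k" using delta_pos by (simp add: mesh_def)
lemma price_pos: "0 < price k" using growth_const_pos by (simp add: price_def)
lemma slack_pos: "0 < slack k" using growth_const_pos mesh_pos by (simp add: slack_def)

lemma mesh_sum_le: "(\<Sum>k\<le>n. 2 powr (real k / 2) * mesh k) \<le> 4 * \<delta>"
proof -
  have "2 powr (real k / 2) * mesh k = \<delta> * 2 powr (- real k / 2)" for k
    unfolding mesh_def by (simp add: powr_add[symmetric] mult.left_commute)
  thus ?thesis using mult_left_mono[OF sum_inverse_sqrt2_le[of n], of \<delta>] delta_pos
    by (simp add: sum_distrib_left mult.commute)
qed

lemma opt_radius_near_min: "x \<in> T \<Longrightarrow> near_min (price k) (slack k) x (opt_radius k x)"
  unfolding opt_radius_def
  by (rule someI_ex[OF near_min_exists[OF _ less_imp_le[OF price_pos] slack_pos]])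

lemma opt_radius_nonneg: "x \<in> T \<Longrightarrow> 0 \<le> opt_radius k x"
  using opt_radius_near_min unfolding near_min_def by blast

lemma opt_radius_min: "x \<in> T \<Longrightarrow> 0 \<le> s \<Longrightarrow> price k * opt_radius k x - ball_G x (opt_radius k x) \<le> price k * s - ball_G x s + slack k"
  using opt_radius_near_min unfolding near_min_def by blast

text \<open>The radius of level \<open>n + 1\<close> is a competitor at level \<open>n\<close>. As
  prices grow by a factor of at least \<open>4 / 3\<close>, passing to the next level raises the
  near-minimal value by at least a quarter of \<open>price (n + 1) * opt_radius (n + 1) x\<close>,
  up to \<open>slack n\<close>; these increments telescope.\<close>

lemma opt_radius_sum_le:
  assumes x: "x \<in> T"
  shows "(\<Sum>k\<le>n. 2 powr (real k / 2) * opt_radius k x) \<le> 1024 * (G T / growth_const + \<delta>)"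
proof -
  define V where "V k = price k * opt_radius k x - ball_G x (opt_radius k x)" for k
  have "(\<Sum>k\<le>n. price k * opt_radius k x / 4) \<le> G T + V n + (\<Sum>k<n. slack k)"
  proof (induction n)
    case 0
    have "0 \<le> price 0 * opt_radius 0 x" using price_pos[of 0] opt_radius_nonneg[OF x] by simp
    thus ?case using ball_G_bounds(2)[OF x opt_radius_nonneg[OF x, of 0]] by (simp add: V_def)
  next
    case (Suc n)
    have q: "2 powr (real n / 2) \<le> 3/4 * 2 powr (real (Suc n) / 2)"
    proof -
      have "1 \<le> 3/4 * sqrt 2" using real_le_rsqrt[of "4/3" 2] by (simp add: power2_eq_square)
      thus ?thesis
        using mult_left_mono[of 1 "3/4 * sqrt 2" "2 powr (real n / 2)"]
        by (simp add: add_divide_distrib powr_add powr_half_sqrt mult_ac)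
    qed
    have "price n \<le> 3/4 * price (Suc n)"
      using mult_left_mono[OF q, of "growth_const / 256"] growth_const_pos by (simp add: price_def mult_ac)
    hence "price n * opt_radius (Suc n) x \<le> 3/4 * price (Suc n) * opt_radius (Suc n) x"
      using opt_radius_nonneg[OF x] by (intro mult_right_mono) auto
    moreover have "V n \<le> price n * opt_radius (Suc n) x - ball_G x (opt_radius (Suc n) x) + slack n"
      unfolding V_def using opt_radius_min[OF x opt_radius_nonneg[OF x]] .
    ultimately show ?case using Suc unfolding V_def by simp
  qed
  \<comment> \<open>Radius \<open>0\<close> is a competitor of value at most
    \<open>0\<close>.\<close>
  also have "V n \<le> slack n"
    using opt_radius_min[OF x, of 0 n] ball_G_bounds(1)[OF x, of 0] by (simp add: V_def)
  hence "G T + V n + (\<Sum>k<n. slack k) \<le> G T + (\<Sum>k\<le>n. slack k)"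
    by (simp add: lessThan_Suc_atMost[symmetric])
  also have "(\<Sum>k\<le>n. slack k) = growth_const / 4 * (\<Sum>k\<le>n. 2 powr (real k / 2) * mesh k)"
    by (simp add: slack_def sum_distrib_left mult_ac)
  also have "\<dots> \<le> growth_const / 4 * (4 * \<delta>)"
    using growth_const_pos by (intro mult_left_mono mesh_sum_le) auto
  also have "(\<Sum>k\<le>n. price k * opt_radius k x / 4) = growth_const / 1024 * (\<Sum>k\<le>n. 2 powr (real k / 2) * opt_radius k x)"
    by (simp add: price_def sum_distrib_left mult_ac)
  finally show ?thesis using growth_const_pos by (simp add: field_simps)
qed

section \<open>Splitting one cell\<close>

text \<open>If the points were separated, the growth condition at the point of least \<open>G\<close>-ball would show that
  enlarging its ball to twice the diameter of \<open>A\<close> gains more than the near-minimality of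
  \<open>opt_radius\<close> allows.\<close>

lemma no_separated_subset:
  assumes A: "A \<noteq> {}" "A \<subseteq> T" and R: "0 < rdiam A"
    and I: "I \<subseteq> {x \<in> A. opt_radius k x \<le> rdiam A / 2048}" "finite I" "card I = 2 ^ (2 ^ k)"
    and sep: "\<forall>u\<in>I. \<forall>v\<in>I. u \<noteq> v \<longrightarrow> rdiam A / 8 + mesh k \<le> d u v"
  shows False
proof -
  let ?R = "rdiam A" and ?\<epsilon> = "rdiam A / 8 + mesh k" and ?b = "2 powr (real k / 2)"
  let ?H = "\<lambda>u. {y \<in> T. d y u \<le> opt_radius k u}"
  have IA: "I \<subseteq> A" "I \<subseteq> T" using I(1) A by auto
  have c2: "2 \<le> card I" using I(3) self_le_power[of "2::nat" "2 ^ k"] by simp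
  then obtain s where s: "s \<in> I" by fastforce
  have "real (card I) = 2 powr (2 ^ k)"
    using powr_realpow[of 2 "2 ^ k"] by (simp add: I(3))
  hence "ln (real (card I)) = 2 ^ k * ln 2" by (simp add: ln_powr)
  hence lncard: "sqrt (ln (real (card I))) = ?b * sqrt (ln 2)"
    by (simp add: real_sqrt_mult powr_half_sqrt[symmetric] powr_realpow[symmetric] powr_powr)
  have "\<exists>u\<in>I. G (?H u) + \<kappa> * sqrt (ln (real (card I))) * ?\<epsilon>\<^sup>2 / ?R \<le> G (\<Union>u\<in>I. ?H u)"
  proof (rule growth[of I s ?R ?\<epsilon> ?H "?R / 2048"])
    show "d u s \<le> ?R" if "u \<in> I" for u using that s IA A by (intro rdiam_ge) auto
    show "?H u \<noteq> {}" if "u \<in> I" for u using that IA d_refl[of u] opt_radius_nonneg[of u k] by force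
    show "d v u \<le> ?R / 2048" if "u \<in> I" "v \<in> ?H u" for u v using that I by fastforce
    \<comment> \<open>The threshold \<open>2048 = 32 * 8\<^sup>2\<close> is chosen for this side
      condition of \<open>growth\<close>.\<close>
    have "(?R / 8)\<^sup>2 \<le> ?\<epsilon>\<^sup>2" using R mesh_pos[of k] by (intro power_mono) auto
    thus "?R / 2048 * ?R \<le> ?\<epsilon>\<^sup>2 / 32" by (simp add: power2_eq_square)
  qed (use I IA c2 s R mesh_pos[of k] sep in auto)
  then obtain u where u: "u \<in> I" "G (?H u) + growth_const * ?b * ?\<epsilon>\<^sup>2 / ?R \<le> G (\<Union>u\<in>I. ?H u)"
    unfolding lncard growth_const_def by (auto simp: mult_ac)
  have uT: "u \<in> T" using u IA by auto
  have "v \<in> {y \<in> T. d y u \<le> 2 * ?R}" if "v \<in> ?H w" "w \<in> I" for v w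
  proof -
    have "d v u \<le> d v w + d w u" using that IA uT by (intro d_tri) auto
    moreover have "d w u \<le> ?R" using that u IA A by (intro rdiam_ge) auto
    moreover have "d v w \<le> ?R / 2048" using that I by fastforce
    ultimately show ?thesis using that R by auto
  qed
  hence "(\<Union>u\<in>I. ?H u) \<subseteq> {y \<in> T. d y u \<le> 2 * ?R}" by blast
  moreover have "u \<in> ?H u" using uT d_refl[of u] opt_radius_nonneg[of u k] by auto
  hence "(\<Union>u\<in>I. ?H u) \<noteq> {}" using u(1) by blast
  ultimately have "G (\<Union>u\<in>I. ?H u) \<le> ball_G u (2 * ?R)"
    unfolding ball_G_def by (intro G_mono) auto
  moreover have "price k * opt_radius k u - ball_G u (opt_radius k u) \<le> price k * (2 * ?R) - ball_G u (2 * ?R) + slack k"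
    using R by (intro opt_radius_min uT) auto
  moreover have "0 \<le> price k * opt_radius k u" using price_pos[of k] opt_radius_nonneg[OF uT, of k] by simp
  ultimately have "growth_const * ?b * ?\<epsilon>\<^sup>2 / ?R \<le> price k * (2 * ?R) + slack k"
    using u(2) unfolding ball_G_def by linarith
  also have "\<dots> = growth_const * ?b * (?R / 128 + mesh k / 4)"
    by (simp add: price_def slack_def field_simps)
  finally have "?\<epsilon>\<^sup>2 / ?R \<le> ?R / 128 + mesh k / 4"
    using growth_const_pos by (simp add: mult.assoc times_divide_eq_right[symmetric] del: times_divide_eq_right)
  \<comment> \<open>The cross term of the square cancels the slack, so that \<open>?R / 64\<close>
    is left against \<open>?R / 128\<close>.\<close>
  moreover have "?\<epsilon>\<^sup>2 / ?R \<ge> ?R / 64 + mesh k / 4"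
    using R by (simp add: field_simps power2_eq_square)
  ultimately show False using R by simp
qed

text \<open>Points with radius above \<open>rdiam A / 2048\<close> form one cell, where
  \<open>2048 * opt_radius k x\<close> pays for the whole diameter. Among the others there are no
  \<open>2 ^ (2 ^ k)\<close> separated points, so fewer than \<open>2 ^ (2 ^ k)\<close> balls of
  radius \<open>rdiam A / 8 + mesh k\<close> cover them.\<close>

lemma split_exists:
  assumes A: "A \<noteq> {}" "A \<subseteq> T"
  shows "\<exists>P. partition_on A P \<and> finite P \<and> card P \<le> 2 ^ (2 ^ k) \<and>
     (\<forall>B\<in>P. \<forall>x\<in>B. rdiam B \<le> rdiam A / 4 + 2048 * opt_radius k x + 2 * mesh k)"
proof (cases "rdiam A = 0")
  case True
  \<comment> \<open>A cell of diameter zero stays whole, because the separation argument divides by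
    the diameter.\<close>
  have "partition_on A {A}" using A by (simp add: partition_on_space)
  moreover have "rdiam A \<le> rdiam A / 4 + 2048 * opt_radius k x + 2 * mesh k" if "x \<in> A" for x
    using True opt_radius_nonneg[of x k] mesh_pos[of k] that A by auto
  ultimately show ?thesis by (intro exI[of _ "{A}"]) auto
next
  case False
  hence R: "0 < rdiam A" using rdiam_nonneg[OF A] by simp
  let ?B = "{x \<in> A. opt_radius k x \<le> rdiam A / 2048}" and ?\<epsilon> = "rdiam A / 8 + mesh k"
  \<comment> \<open>One of the \<open>2 ^ (2 ^ k)\<close> cells is reserved for the points of large
    radius.\<close>
  let ?m = "2 ^ (2 ^ k) - 1 :: nat"
  have Suc_m: "Suc ?m = 2 ^ (2 ^ k)" by simp
  obtain J where J: "finite J" "J \<subseteq> ?B" "card J \<le> ?m" "\<And>x. x \<in> ?B \<Longrightarrow> \<exists>c\<in>J. d x c < ?\<epsilon>"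
  proof (rule separated_set_or_cover[of ?B ?m ?\<epsilon> d])
    fix I assume "I \<subseteq> ?B" "finite I" "card I = Suc ?m"
    thus "\<not> (\<forall>u\<in>I. \<forall>v\<in>I. u \<noteq> v \<longrightarrow> ?\<epsilon> \<le> d u v)"
      using no_separated_subset[OF A R, of I k] by (simp only: Suc_m) blast
  qed (use A d_sym d_refl R mesh_pos[of k] in \<open>auto simp: add_pos_pos subset_eq\<close>)
  \<comment> \<open>The label is \<open>None\<close> for large radius and otherwise the centre of a
    covering ball; the cells are the fibres of \<open>g\<close>.\<close>
  define g where "g x = (if x \<in> ?B then Some (SOME c. c \<in> J \<and> d x c < ?\<epsilon>) else None)" for x
  have g: "(SOME c. c \<in> J \<and> d x c < ?\<epsilon>) \<in> J \<and> d x (SOME c. c \<in> J \<and> d x c < ?\<epsilon>) < ?\<epsilon>" if "x \<in> ?B" for x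
    using someI_ex[of "\<lambda>c. c \<in> J \<and> d x c < ?\<epsilon>"] J(4)[OF that] by blast
  let ?P = "(\<lambda>c. {x \<in> A. g x = c}) ` g ` A"
  have gA: "g ` A \<subseteq> insert None (Some ` J)" using g by (auto simp: g_def)
  have fin: "finite (g ` A)" using finite_subset[OF gA] J(1) by simp
  have "card ?P \<le> card (g ` A)" using fin by (rule card_image_le)
  also have "\<dots> \<le> card (insert None (Some ` J))" using J(1) by (intro card_mono gA) auto
  also have "\<dots> = Suc (card J)" using J(1) by (subst card_insert_disjoint) (auto simp: card_image)
  also have "\<dots> \<le> Suc ?m" using J(3) by (simp only: Suc_le_mono)
  finally have card: "card ?P \<le> 2 ^ (2 ^ k)" by (simp only: Suc_m)
  have bound: "rdiam B \<le> rdiam A / 4 + 2048 * opt_radius k x + 2 * mesh k" if B: "B \<in> ?P" and x: "x \<in> B" for B x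
  proof -
    obtain c where c: "B = {x \<in> A. g x = c}" using B by blast
    have BA: "B \<subseteq> A" "B \<noteq> {}" using c x by auto
    have xT: "x \<in> T" using x BA A by auto
    show ?thesis
    proof (cases c)
      case None
      hence "rdiam A / 2048 < opt_radius k x" using x c by (auto simp: g_def split: if_splits)
      moreover have "rdiam B \<le> rdiam A" using BA A by (intro rdiam_mono)
      ultimately show ?thesis using R mesh_pos[of k] by linarith
    next
      case (Some e)
      have "e \<in> J \<and> d y e < ?\<epsilon>" if "y \<in> B" for y
        using that g[of y] unfolding c Some g_def by (auto split: if_splits)
      hence e: "e \<in> T" "\<And>y. y \<in> B \<Longrightarrow> d y e < ?\<epsilon>" using J(2) A x by auto
      have "d y z \<le> 2 * ?\<epsilon>" if "y \<in> B" "z \<in> B" for y z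
      proof -
        have "y \<in> T" "z \<in> T" using that BA A by auto
        thus ?thesis using e(2)[OF that(1)] e(2)[OF that(2)] d_tri[of y e z] d_sym[of e z] e(1) by simp
      qed
      hence "rdiam B \<le> 2 * ?\<epsilon>" using BA by (intro rdiam_le)
      thus ?thesis using opt_radius_nonneg[OF xT, of k] by simp
    qed
  qed
  show ?thesis
  proof (rule exI[of _ ?P], intro conjI)
    show "partition_on A ?P" by (rule fibre_partition_on)
    show "finite ?P" by (rule finite_imageI[OF fin])
    show "card ?P \<le> 2 ^ (2 ^ k)" by (rule card)
    show "\<forall>B\<in>?P. \<forall>x\<in>B. rdiam B \<le> rdiam A / 4 + 2048 * opt_radius k x + 2 * mesh k"
    proof (rule ballI, rule ballI)
      fix B x assume "B \<in> ?P" "x \<in> B"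
      thus "rdiam B \<le> rdiam A / 4 + 2048 * opt_radius k x + 2 * mesh k" by (rule bound)
    qed
  qed
qed

section \<open>Iterated splitting and the chaining sum\<close>

definition good_split :: "nat \<Rightarrow> 'a set \<Rightarrow> 'a set set \<Rightarrow> bool" where
  "good_split k A P \<longleftrightarrow> partition_on A P \<and> finite P \<and> card P \<le> 2 ^ (2 ^ k) \<and>
     (\<forall>B\<in>P. \<forall>x\<in>B. rdiam B \<le> rdiam A / 4 + 2048 * opt_radius k x + 2 * mesh k)"

definition split_cell :: "nat \<Rightarrow> 'a set \<Rightarrow> 'a set set" where
  "split_cell k A = (SOME P. good_split k A P)"

lemma split_cell:
  assumes "A \<noteq> {}" "A \<subseteq> T"
  shows "partition_on A (split_cell k A)" "finite (split_cell k A)" "card (split_cell k A) \<le> 2 ^ (2 ^ k)"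
    "\<And>B x. B \<in> split_cell k A \<Longrightarrow> x \<in> B \<Longrightarrow> rdiam B \<le> rdiam A / 4 + 2048 * opt_radius k x + 2 * mesh k"
proof -
  have "\<exists>P. good_split k A P" using split_exists[OF assms] unfolding good_split_def .
  hence "good_split k A (split_cell k A)" unfolding split_cell_def by (rule someI_ex)
  thus "partition_on A (split_cell k A)" "finite (split_cell k A)" "card (split_cell k A) \<le> 2 ^ (2 ^ k)"
    "\<And>B x. B \<in> split_cell k A \<Longrightarrow> x \<in> B \<Longrightarrow> rdiam B \<le> rdiam A / 4 + 2048 * opt_radius k x + 2 * mesh k"
    unfolding good_split_def by blast+
qed

primrec chain_part :: "nat \<Rightarrow> 'a set set" where
  "chain_part 0 = {T}"
| "chain_part (Suc k) = (\<Union>A\<in>chain_part k. split_cell k A)"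

text \<open>Each cell of level \<open>k\<close> has at most \<open>2 ^ (2 ^ k)\<close> children, and
  the square of \<open>2 ^ (2 ^ k)\<close> is \<open>2 ^ (2 ^ Suc k)\<close>, the bound required at
  the next level.\<close>

lemma chain_part: "partition_on T (chain_part k)" "finite (chain_part k)" "card (chain_part k) \<le> 2 ^ (2 ^ k)"
proof (induction k)
  case 0
  show "partition_on T (chain_part 0)" using T_ne by (simp add: partition_on_space)
  show "finite (chain_part 0)" by simp
  show "card (chain_part 0) \<le> 2 ^ (2 ^ 0)" by simp
next
  case (Suc k)
  have ne: "A \<noteq> {}" "A \<subseteq> T" if "A \<in> chain_part k" for A
    using that Suc(1) by (auto simp: partition_on_def)
  show "partition_on T (chain_part (Suc k))"
    unfolding chain_part.simps using Suc(1) split_cell(1)[OF ne] by (intro partition_on_UN_split)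
  show "finite (chain_part (Suc k))" using Suc(2) split_cell(2)[OF ne] by auto
  have "card (chain_part (Suc k)) \<le> (\<Sum>A\<in>chain_part k. card (split_cell k A))"
    using card_UN_le[OF Suc(2)] by simp
  also have "\<dots> \<le> (\<Sum>A\<in>chain_part k. 2 ^ (2 ^ k))" by (intro sum_mono split_cell(3)[OF ne])
  also have "\<dots> \<le> 2 ^ (2 ^ k) * 2 ^ (2 ^ k)" using Suc(3) by simp
  also have "\<dots> = 2 ^ (2 ^ Suc k)" by (simp flip: power_add)
  finally show "card (chain_part (Suc k)) \<le> 2 ^ (2 ^ Suc k)" .
qed

lemma chain_part_cell: "A \<in> chain_part k \<Longrightarrow> A \<noteq> {} \<and> A \<subseteq> T"
  using chain_part(1)[of k] by (auto simp: partition_on_def)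

lemma admissible_chain_part: "admissible T chain_part"
proof -
  have "\<exists>Y\<in>chain_part k. X \<subseteq> Y" if X: "X \<in> chain_part (Suc k)" for X k
  proof -
    obtain Y where Y: "Y \<in> chain_part k" "X \<in> split_cell k Y" using X by auto
    hence "X \<subseteq> Y" using split_cell(1)[of Y k] chain_part_cell[OF Y(1)] by (auto simp: partition_on_def)
    thus ?thesis using Y(1) by blast
  qed
  moreover have "card (chain_part 0) = 1" by simp
  ultimately show ?thesis unfolding admissible_def refines_def using chain_part by blast
qed

text \<open>Along the cells of \<open>x\<close> the diameters shrink by a factor of \<open>4\<close>
  up to errors, while the weights grow only by \<open>sqrt 2\<close>. The sum thus reappears on the
  right with a factor of at most \<open>3/8\<close> and is absorbed; the first diameter and the sums
  of radii and meshes remain.\<close>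

lemma chain_sum_le:
  assumes x: "x \<in> T"
  shows "(\<Sum>k<n. ennreal (2 powr (real k / 2)) * diam d (part_of (chain_part k) x)) \<le>
    ennreal (10 ^ 7 * (G T / growth_const + \<delta>))"
proof -
  define c where "c k = part_of (chain_part k) x" for k
  let ?b = "\<lambda>k. 2 powr (real k / 2) :: real"
  have c: "c k \<in> chain_part k" "x \<in> c k" for k
  proof -
    obtain A where A: "A \<in> chain_part k" "x \<in> A" 
      using chain_part(1)[of k] x by (auto simp: partition_on_def)
    thus "c k \<in> chain_part k" "x \<in> c k" using part_of_eq[OF chain_part(1) A] by (auto simp: c_def)
  qed
  note cell = chain_part_cell[OF c(1)]
  have step: "rdiam (c (Suc k)) \<le> rdiam (c k) / 4 + 2048 * opt_radius k x + 2 * mesh k" for k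
  proof -
    obtain A where A: "A \<in> chain_part k" "c (Suc k) \<in> split_cell k A" using c(1)[of "Suc k"] by auto
    have "x \<in> A" using A c(2)[of "Suc k"] split_cell(1)[of A k] chain_part_cell[OF A(1)] 
      by (auto simp: partition_on_def)
    hence "A = c k" using part_of_eq[OF chain_part(1) A(1)] by (simp add: c_def)
    thus ?thesis using split_cell(4)[of A "c (Suc k)" k x] A c(2) chain_part_cell[OF A(1)] by auto
  qed
  let ?M = "G T / growth_const + \<delta>"
  have GT: "0 \<le> G T / growth_const" using G_nonneg[of T] T_ne growth_const_pos by simp
  have s2: "sqrt 2 \<le> 3/2" by (rule real_le_lsqrt) (auto simp: power2_eq_square)
  have real: "(\<Sum>k\<le>n. ?b k * rdiam (c k)) \<le> 10 ^ 7 * ?M" for n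
  proof -
    have "(\<Sum>k\<le>n. ?b k * rdiam (c k)) \<le> (\<Sum>k\<le>Suc n. ?b k * rdiam (c k))"
      using rdiam_nonneg cell by simp
    also have "\<dots> = rdiam (c 0) + (\<Sum>k\<le>n. sqrt 2 * (?b k * rdiam (c (Suc k))))"
      by (subst sum.atMost_Suc_shift) (simp add: add_divide_distrib powr_add powr_half_sqrt mult_ac)
    also have "\<dots> \<le> rdiam (c 0) + (\<Sum>k\<le>n. 3/2 * (?b k * (rdiam (c k) / 4 + 2048 * opt_radius k x + 2 * mesh k)))"
      using step s2 rdiam_nonneg cell by (intro add_left_mono sum_mono mult_mono) auto
    also have "\<dots> = rdiam (c 0) + 3/8 * (\<Sum>k\<le>n. ?b k * rdiam (c k)) + 3072 * (\<Sum>k\<le>n. ?b k * opt_radius k x)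
        + 3 * (\<Sum>k\<le>n. ?b k * mesh k)"
      by (simp add: sum.distrib[symmetric] sum_distrib_left algebra_simps)
    \<comment> \<open>The constant \<open>10 ^ 7\<close> exceeds
      \<open>8/5 * (1 + 3072 * 1024 + 12)\<close>.\<close>
    finally have "5/8 * (\<Sum>k\<le>n. ?b k * rdiam (c k)) \<le> rdiam T + 3072 * (1024 * ?M) + 3 * (4 * \<delta>)"
      using opt_radius_sum_le[OF x, of n] mesh_sum_le[of n] c(1)[of 0] by simp
    moreover have "rdiam T \<le> G T / growth_const" using growth_const_rdiam_le growth_const_pos by (simp add: field_simps)
    ultimately show ?thesis using delta_pos GT by simp
  qed
  have "(\<Sum>k<n. ennreal (?b k) * diam d (c k)) \<le> (\<Sum>k\<le>n. ennreal (?b k) * ennreal (rdiam (c k)))"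
    using cell by (intro order.trans[OF sum_mono2[of "{..n}" "{..<n}"] sum_mono] mult_left_mono diam_le_rdiam) auto
  also have "\<dots> = ennreal (\<Sum>k\<le>n. ?b k * rdiam (c k))"
    using rdiam_nonneg cell by (subst sum_ennreal[symmetric]) (auto simp: ennreal_mult)
  also have "\<dots> \<le> ennreal (10 ^ 7 * ?M)" by (intro ennreal_leI real)
  finally show ?thesis by (simp add: c_def)
qed

lemma gamma2_le_approx: "gamma2 T d \<le> ennreal (10 ^ 7 * (G T / growth_const + \<delta>))"
  unfolding gamma2_def using admissible_chain_part chain_sum_le
  by (intro INF_lower2[of chain_part] SUP_least suminf_le_const) auto

end

text \<open>The error parameter \<open>\<delta>\<close> of the near-minimal radii is sent to
  zero.\<close>

theorem gamma2_le: "gamma2 T d \<le> ennreal (10 ^ 7 * G T / growth_const)"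
proof (rule ennreal_le_epsilon)
  fix e :: real assume e: "0 < e"
  have "gamma2 T d \<le> ennreal (10 ^ 7 * (G T / growth_const + e / 10 ^ 7))"
    using e by (intro gamma2_le_approx) auto
  also have "\<dots> = ennreal (10 ^ 7 * G T / growth_const) + ennreal e"
    using e G_nonneg[of T] T_ne growth_const_pos by (subst ennreal_plus[symmetric]) (auto simp: algebra_simps)
  finally show "gamma2 T d \<le> ennreal (10 ^ 7 * G T / growth_const) + ennreal e" .
qed

end

section \<open>Variational bounds for the Kullback-Leibler divergence\<close>

text \<open>The derivative is finite almost everywhere, so its real-valued version is still a
  density and real integrals can be used.\<close>

lemma density_enn2real_RN_deriv:
  assumes "prob_space P" "prob_space Q" "absolutely_continuous Q P" "sets P = sets Q"
  shows "density Q (\<lambda>x. ennreal (enn2real (RN_deriv Q P x))) = P"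
proof -
  interpret P: prob_space P by fact
  interpret Q: prob_space Q by fact
  have "AE x in Q. RN_deriv Q P x \<noteq> \<infinity>"
    using assms by (intro Q.RN_deriv_finite P.sigma_finite_measure_axioms) auto
  hence "density Q (\<lambda>x. ennreal (enn2real (RN_deriv Q P x))) = density Q (RN_deriv Q P)"
    by (intro density_cong) (auto simp: less_top)
  also have "\<dots> = P" using assms by (intro Q.density_RN_deriv) auto
  finally show ?thesis .
qed

text \<open>Young's inequality for the convex conjugates \<open>y * ln y - y\<close> and
  \<open>exp h\<close>.\<close>

lemma mult_le_entropy_exp:
  fixes y h :: real
  assumes "0 \<le> y"
  shows "y * h \<le> y * ln y - y + exp h"
proof (cases "y = 0")
  case False
  hence y: "0 < y" using assms by simp
  have "1 + (h - ln y) \<le> exp (h - ln y)" by (rule exp_ge_add_one_self)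
  hence "y * (1 + (h - ln y)) \<le> y * exp (h - ln y)" using y by (intro mult_left_mono) auto
  also have "y * exp (h - ln y) = exp h" using y by (simp add: exp_diff)
  finally show ?thesis by (simp add: algebra_simps)
qed simp

text \<open>The Donsker-Varadhan inequality with \<open>ln z\<close> relaxed to
  \<open>z - 1\<close>, obtained by integrating Young's inequality at the density of
  \<open>P\<close>. Shifting \<open>h\<close> by a constant recovers the loss where it
  matters.\<close>

lemma KL_variational:
  assumes P: "prob_space P" and Q: "prob_space Q" and sets: "sets P = sets Q"
    and KL: "KL P Q \<le> ereal K"
    and h: "h \<in> borel_measurable Q" and B: "\<And>x. \<bar>h x\<bar> \<le> B"
  shows "absolutely_continuous Q P" "(\<integral>x. h x \<partial>P) \<le> K - 1 + (\<integral>x. exp (h x) \<partial>Q)"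
proof -
  interpret P: prob_space P by fact
  interpret Q: prob_space Q by fact
  note [measurable] = h
  show ac: "absolutely_continuous Q P"
    using KL by (auto simp: KL_def split: if_splits)
  have int: "integrable P (entropy_density (exp 1) Q P)"
    and KL': "(\<integral>x. entropy_density (exp 1) Q P x \<partial>P) \<le> K"
    using KL by (auto simp: KL_def KL_divergence_def split: if_splits)
  define f where "f = (\<lambda>x. enn2real (RN_deriv Q P x))"
  have f[measurable]: "f \<in> borel_measurable Q" unfolding f_def by measurable
  have f0: "0 \<le> f x" for x by (simp add: f_def)
  have dens: "density Q (\<lambda>x. ennreal (f x)) = P"
    unfolding f_def using P Q ac sets by (rule density_enn2real_RN_deriv)
  have ent: "entropy_density (exp 1) Q P = (\<lambda>x. ln (f x))"
    by (auto simp: entropy_density_def f_def log_def)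
  have hP[measurable]: "h \<in> borel_measurable P" using h unfolding measurable_cong_sets[OF sets refl] .
  have hint: "integrable P h" using B by (intro P.integrable_const_bound[of _ B]) auto
  have eint: "integrable Q (\<lambda>x. exp (h x))"
    using B by (intro Q.integrable_const_bound[of _ "exp B"]) (auto intro: order.trans[OF abs_ge_self])
  have i1: "integrable Q (\<lambda>x. f x * h x)" 
    using integrable_real_density[of f Q h] f0 hint dens by simp
  have i2: "integrable Q (\<lambda>x. f x * ln (f x))" 
    using integrable_real_density[of f Q "\<lambda>x. ln (f x)"] f0 int dens ent by simp
  have i3: "integrable Q f" 
    using integrable_real_density[of f Q "\<lambda>_. 1"] f0 dens by simp
  have "(\<integral>x. h x \<partial>P) = (\<integral>x. f x * h x \<partial>Q)"
    using integral_real_density[of f Q h] f0 dens by simp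
  also have "\<dots> \<le> (\<integral>x. f x * ln (f x) - f x + exp (h x) \<partial>Q)"
    using i1 i2 i3 eint f0 by (intro integral_mono mult_le_entropy_exp) auto
  also have "\<dots> = (\<integral>x. f x * ln (f x) \<partial>Q) - (\<integral>x. f x \<partial>Q) + (\<integral>x. exp (h x) \<partial>Q)"
    using i2 i3 eint by simp
  also have "(\<integral>x. f x * ln (f x) \<partial>Q) = (\<integral>x. entropy_density (exp 1) Q P x \<partial>P)"
    using integral_real_density[of f Q "\<lambda>x. ln (f x)"] f0 dens ent by simp
  also have "(\<integral>x. f x \<partial>Q) = 1"
    using integral_real_density[of f Q "\<lambda>_. 1"] f0 dens P.prob_space by simp
  finally show "(\<integral>x. h x \<partial>P) \<le> K - 1 + (\<integral>x. exp (h x) \<partial>Q)" using KL' by simp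
qed

section \<open>A Fano inequality for posterior samples\<close>

lemma exp_mult_le_linear:
  fixes p :: real
  assumes "0 \<le> p" "p \<le> 1"
  shows "exp (L * p) \<le> 1 + (exp L - 1) * p"
proof -
  have "exp ((1 - p) *\<^sub>R 0 + p *\<^sub>R L) \<le> (1 - p) * exp 0 + p * exp L"
    using assms by (intro convex_onD[OF exp_convex]) auto
  thus ?thesis by (simp add: algebra_simps)
qed

text \<open>It amounts to \<open>(2 - 1 / m) ^ 3 \<le> m\<^sup>2\<close>, which reads
  \<open>27 / 8 \<le> 4\<close> for \<open>m = 2\<close> and follows from \<open>8 \<le> 9\<close>
  beyond.\<close>

lemma ln_two_minus_inverse_le:
  fixes m :: nat
  assumes "2 \<le> m"
  shows "ln (2 - 1 / m) \<le> 2 / 3 * ln m"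
proof -
  have pos: "0 < 2 - 1 / real m" using assms by (simp add: field_simps)
  have "(2 - 1 / m) ^ 3 \<le> real m ^ 2"
  proof (cases "m = 2")
    case False
    have "(2 - 1 / real m) ^ 3 \<le> 2 ^ 3" using pos by (intro power_mono) auto
    also have "\<dots> \<le> real 3 ^ 2" by simp
    also have "\<dots> \<le> real m ^ 2" using assms False by (intro power_mono) auto
    finally show ?thesis .
  qed (simp add: power3_eq_cube power2_eq_square)
  hence "ln ((2 - 1 / m) ^ 3) \<le> ln (real m ^ 2)" using pos assms by (intro ln_mono) auto
  thus ?thesis using pos assms by (simp add: ln_realpow)
qed

text \<open>If \<open>p t\<close> is the posterior probability of \<open>t\<close> under a uniform
  prior, the sum divided by \<open>card I\<close> is the probability that a fresh posterior sample
  hits the hidden index. The variational bound is tested with \<open>L * p t x - b\<close>, where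
  \<open>L = ln (card I)\<close>, and summed over \<open>t\<close>.\<close>

lemma posterior_collision_le:
  fixes p :: "'i \<Rightarrow> 'a \<Rightarrow> real"
  assumes I: "finite I" "2 \<le> card I" and Q: "prob_space Q"
    and P: "\<And>t. t \<in> I \<Longrightarrow> prob_space (P t)" "\<And>t. t \<in> I \<Longrightarrow> sets (P t) = sets Q"
    and var: "\<And>t h B. t \<in> I \<Longrightarrow> h \<in> borel_measurable Q \<Longrightarrow> (\<And>x. \<bar>h x\<bar> \<le> B) \<Longrightarrow>
        (\<integral>x. h x \<partial>P t) \<le> K - 1 + (\<integral>x. exp (h x) \<partial>Q)"
    and K: "K \<le> ln (card I) / 12"
    and p: "\<And>t. t \<in> I \<Longrightarrow> p t \<in> borel_measurable Q" "\<And>t x. t \<in> I \<Longrightarrow> 0 \<le> p t x"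
       "\<And>t x. t \<in> I \<Longrightarrow> p t x \<le> 1" "\<And>x. (\<Sum>t\<in>I. p t x) \<le> 1"
  shows "(\<Sum>t\<in>I. \<integral>x. p t x \<partial>P t) \<le> 3 / 4 * card I"
proof -
  interpret Q: prob_space Q by fact
  define m where "m = real (card I)"
  define L where "L = ln m"
  define b where "b = ln (2 - 1 / m)" \<comment> \<open>makes the average over \<open>t\<close> of \<open>E\<^sub>Q exp (L p\<^sub>t - b)\<close> at most 1\<close>
  have m: "2 \<le> m" using I by (simp add: m_def)
  have L: "0 < L" using m by (simp add: L_def)
  have bpos: "0 < 2 - 1 / m" using m by (simp add: field_simps)
  have b: "exp b = 2 - 1 / m" using bpos by (simp add: b_def)
  have bL: "b \<le> 2 / 3 * L" using ln_two_minus_inverse_le[OF I(2)] by (simp add: b_def L_def m_def)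
  have eL: "exp L = m" using m by (simp add: L_def)
  have pint: "integrable Q (p t)" if "t \<in> I" for t
    using p that by (intro Q.integrable_const_bound[of _ 1]) auto
  have step: "L * (\<integral>x. p t x \<partial>P t) - b \<le> K - 1 + exp (- b) * (1 + (m - 1) * (\<integral>x. p t x \<partial>Q))"
    if t: "t \<in> I" for t
  proof -
    interpret Pt: prob_space "P t" using P(1) t .
    have [measurable]: "p t \<in> borel_measurable Q" using p t by auto
    have pP: "p t \<in> borel_measurable (P t)" using p(1)[OF t] unfolding measurable_cong_sets[OF P(2)[OF t] refl] .
    have "integrable (P t) (p t)"
      using p t pP by (intro Pt.integrable_const_bound[of _ 1]) auto
    hence "L * (\<integral>x. p t x \<partial>P t) - b = (\<integral>x. L * p t x - b \<partial>P t)"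
      by (simp add: Pt.prob_space)
    also have "\<dots> \<le> K - 1 + (\<integral>x. exp (L * p t x - b) \<partial>Q)"
    proof (rule var[OF t, of _ "L + \<bar>b\<bar>"])
      fix x
      have "0 \<le> L * p t x" "L * p t x \<le> L * 1"
        using p(2)[OF t] p(3)[OF t, of x] L by (auto intro!: mult_left_mono)
      thus "\<bar>L * p t x - b\<bar> \<le> L + \<bar>b\<bar>" by linarith
    qed simp
    \<comment> \<open>The chord bound for \<open>exp\<close> is linear in \<open>p t\<close>, so
      that only the total mass of the \<open>p t\<close> under \<open>Q\<close> enters after
      summation.\<close>
    also have "(\<integral>x. exp (L * p t x - b) \<partial>Q) \<le> (\<integral>x. exp (- b) * (1 + (m - 1) * p t x) \<partial>Q)"
    proof (rule integral_mono_AE')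
      show "integrable Q (\<lambda>x. exp (- b) * (1 + (m - 1) * p t x))" using pint[OF t] by simp
      show "AE x in Q. exp (L * p t x - b) \<le> exp (- b) * (1 + (m - 1) * p t x)"
        using exp_mult_le_linear[OF p(2)[OF t] p(3)[OF t], of L] 
        by (auto simp: exp_diff exp_minus eL divide_simps mult.commute)
      show "AE x in Q. 0 \<le> exp (- b) * (1 + (m - 1) * p t x)"
        using m p(2)[OF t] by (intro AE_I2 mult_nonneg_nonneg add_nonneg_nonneg) auto
    qed
    also have "\<dots> = exp (- b) * (1 + (m - 1) * (\<integral>x. p t x \<partial>Q))"
      using pint[OF t] by (simp add: Q.prob_space)
    finally show ?thesis by simp
  qed
  have "(\<Sum>t\<in>I. \<integral>x. p t x \<partial>Q) = (\<integral>x. (\<Sum>t\<in>I. p t x) \<partial>Q)" using pint by simp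
  also have "\<dots> \<le> (\<integral>x. 1 \<partial>Q)" using pint p(4) by (intro integral_mono) auto
  finally have sumQ: "(\<Sum>t\<in>I. \<integral>x. p t x \<partial>Q) \<le> 1" by (simp add: Q.prob_space)
  let ?X = "\<Sum>t\<in>I. \<integral>x. p t x \<partial>P t"
  have "L * ?X - m * b = (\<Sum>t\<in>I. L * (\<integral>x. p t x \<partial>P t) - b)"
    by (simp add: sum_subtractf sum_distrib_left m_def)
  also have "\<dots> \<le> (\<Sum>t\<in>I. K - 1 + exp (- b) * (1 + (m - 1) * (\<integral>x. p t x \<partial>Q)))"
    by (intro sum_mono step)
  also have "\<dots> = m * (K - 1) + exp (- b) * (m + (m - 1) * (\<Sum>t\<in>I. \<integral>x. p t x \<partial>Q))"
    by (simp add: sum.distrib sum_distrib_left[symmetric] m_def)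
  also have "\<dots> \<le> m * (K - 1) + exp (- b) * (m + (m - 1) * 1)"
    using m sumQ by (intro add_left_mono mult_left_mono) auto
  also have "exp (- b) * (m + (m - 1) * 1) = m"
    using m bpos by (simp add: exp_minus b field_simps)
  finally have "L * ?X \<le> m * (b + K)" by (simp add: algebra_simps)
  \<comment> \<open>Here \<open>2 / 3 + 1 / 12 = 3 / 4\<close>.\<close>
  also have "\<dots> \<le> m * (3 / 4 * L)" 
    using m bL K by (intro mult_left_mono) (auto simp: L_def m_def)
  finally have "L * ?X \<le> L * (3 / 4 * m)" by (simp add: mult_ac)
  thus ?thesis using L unfolding m_def by (simp add: mult_le_cancel_left_pos)
qed

section \<open>Exchangeability of the hidden index and the fresh sample\<close>

text \<open>The matrix \<open>w t * w u / S\<close> is, up to scaling, the law of two independent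
  draws from the posterior. Its marginals are \<open>w\<close>, its symmetry replaces
  \<open>q t u\<close> by half of \<open>q t u + q u t\<close>, and the subtracted
  \<open>\<Sum>t\<in>I. w t * (w t / S)\<close> is its mass on the diagonal.\<close>

lemma weighted_pairing:
  fixes w a b :: "'i \<Rightarrow> real" and q :: "'i \<Rightarrow> 'i \<Rightarrow> real"
  assumes I: "finite I" and w: "\<And>t. t \<in> I \<Longrightarrow> 0 \<le> w t" and l: "0 \<le> l"
    and ab: "\<And>t u. t \<in> I \<Longrightarrow> u \<in> I \<Longrightarrow> b u + l * q t u - e \<le> a t"
    and q: "\<And>t u. t \<in> I \<Longrightarrow> u \<in> I \<Longrightarrow> (if t = u then 0 else g) \<le> q t u + q u t"
  defines "S \<equiv> \<Sum>t\<in>I. w t"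
  shows "(\<Sum>t\<in>I. w t * b t) + l * g / 2 * (S - (\<Sum>t\<in>I. w t * (w t / S))) - e * S \<le> (\<Sum>t\<in>I. w t * a t)"
proof (cases "S = 0")
  case True
  hence "w t = 0" if "t \<in> I" for t
    using that sum_nonneg_eq_0_iff[OF I w] by (simp add: S_def)
  thus ?thesis by (simp add: True)
next
  case False
  have S: "0 < S" using False w sum_nonneg[of I w] by (simp add: S_def)
  define W where "W t u = w t * w u / S" for t u
  have W0: "0 \<le> W t u" if "t \<in> I" "u \<in> I" for t u using that w S by (simp add: W_def)
  have row: "(\<Sum>u\<in>I. W t u) = w t" for t
    using S by (simp add: W_def sum_divide_distrib[symmetric] sum_distrib_left[symmetric] S_def)
  have Wsym: "W t u = W u t" for t u by (simp add: W_def)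
  have "2 * (\<Sum>t\<in>I. \<Sum>u\<in>I. W t u * q t u) = (\<Sum>t\<in>I. \<Sum>u\<in>I. W t u * q t u) + (\<Sum>u\<in>I. \<Sum>t\<in>I. W t u * q t u)"
    by (subst (2) sum.swap) simp
  also have "\<dots> = (\<Sum>t\<in>I. \<Sum>u\<in>I. W t u * (q t u + q u t))"
    by (simp add: sum.distrib[symmetric] algebra_simps Wsym)
  also have "\<dots> \<ge> (\<Sum>t\<in>I. \<Sum>u\<in>I. W t u * (if t = u then 0 else g))"
    by (intro sum_mono mult_left_mono q W0)
  also have "(\<Sum>t\<in>I. \<Sum>u\<in>I. W t u * (if t = u then 0 else g)) = (\<Sum>t\<in>I. g * (w t - W t t))"
  proof (intro sum.cong refl)
    fix t assume t: "t \<in> I"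
    have "(\<Sum>u\<in>I. W t u * (if t = u then 0 else g)) = (\<Sum>u\<in>I. g * W t u - (if u = t then g * W t t else 0))"
      by (intro sum.cong) auto
    also have "\<dots> = g * (w t - W t t)"
      using I t by (simp add: sum_subtractf sum_distrib_left[symmetric] row algebra_simps)
    finally show "(\<Sum>u\<in>I. W t u * (if t = u then 0 else g)) = g * (w t - W t t)" .
  qed
  also have "\<dots> = g * (S - (\<Sum>t\<in>I. w t * (w t / S)))"
    by (simp add: sum_distrib_left[symmetric] sum_subtractf S_def[symmetric] W_def)
  finally have "g * (S - (\<Sum>t\<in>I. w t * (w t / S))) \<le> 2 * (\<Sum>t\<in>I. \<Sum>u\<in>I. W t u * q t u)" .
  from mult_left_mono[OF this l]
  have 1: "l * g / 2 * (S - (\<Sum>t\<in>I. w t * (w t / S))) \<le> l * (\<Sum>t\<in>I. \<Sum>u\<in>I. W t u * q t u)"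
    by (simp add: mult_ac)
  have "(\<Sum>t\<in>I. \<Sum>u\<in>I. W t u * b u) = (\<Sum>u\<in>I. \<Sum>t\<in>I. W u t * b u)"
    by (subst sum.swap) (simp add: Wsym)
  also have "\<dots> = (\<Sum>u\<in>I. w u * b u)" by (simp add: sum_distrib_right[symmetric] row)
  finally have 2: "(\<Sum>t\<in>I. \<Sum>u\<in>I. W t u * b u) = (\<Sum>u\<in>I. w u * b u)" .
  have 3: "(\<Sum>t\<in>I. \<Sum>u\<in>I. W t u * e) = e * S"
    by (simp add: sum_distrib_right[symmetric] row S_def)
  have "(\<Sum>u\<in>I. w u * b u) + l * (\<Sum>t\<in>I. \<Sum>u\<in>I. W t u * q t u) - e * S
      = (\<Sum>t\<in>I. \<Sum>u\<in>I. W t u * (b u + l * q t u - e))"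
    unfolding 2[symmetric] 3[symmetric]
    by (simp add: sum.distrib sum_subtractf sum_distrib_left algebra_simps)
  also have "\<dots> \<le> (\<Sum>t\<in>I. \<Sum>u\<in>I. W t u * a t)"
    by (intro sum_mono mult_left_mono ab W0)
  also have "\<dots> = (\<Sum>t\<in>I. w t * a t)" by (simp add: sum_distrib_right[symmetric] row)
  finally show ?thesis using 1 by linarith
qed

section \<open>Suprema of linear functionals\<close>

lemma ip_diff_left: "ip n (\<lambda>i. x i - y i) z = ip n x z - ip n y z"
  by (simp add: ip_def sum_subtractf algebra_simps)

lemma ip_diff_right: "ip n z (\<lambda>i. x i - y i) = ip n z x - ip n z y"
  by (simp add: ip_def sum_subtractf algebra_simps)

lemma ip_scale_left: "ip n (\<lambda>i. c * x i) z = c * ip n x z"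
  by (simp add: ip_def sum_distrib_left mult_ac)

lemma abs_ip_le: "\<bar>ip n x y\<bar> \<le> nrm n x * nrm n y"
proof -
  have "\<bar>ip n x y\<bar> \<le> (\<Sum>i<n. \<bar>x i\<bar> * \<bar>y i\<bar>)"
    unfolding ip_def by (rule order.trans[OF sum_abs]) (simp add: abs_mult)
  also have "\<dots> \<le> nrm n x * nrm n y" unfolding nrm_def by (rule L2_set_mult_ineq)
  finally show ?thesis .
qed

lemma nrm_nonneg: "0 \<le> nrm n x"
  by (simp add: nrm_def)

lemma edist_nonneg: "0 \<le> edist n x y"
  by (simp add: edist_def nrm_nonneg)

lemma edist_refl: "edist n x x = 0"
  by (simp add: edist_def nrm_def L2_set_def)

lemma edist_sym: "edist n x y = edist n y x"
  by (simp add: edist_def nrm_def L2_set_def power2_commute)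

lemma edist_triangle: "edist n x z \<le> edist n x y + edist n y z"
  using L2_set_triangle_ineq[of "\<lambda>i. x i - y i" "\<lambda>i. y i - z i" "{..<n}"]
  by (simp add: edist_def nrm_def)

lemma edist_le_nrm: "edist n x y \<le> nrm n x + nrm n y"
  using edist_triangle[of n x y "\<lambda>_. 0"] edist_sym[of n y "\<lambda>_. 0"] 
  by (simp add: edist_def nrm_def L2_set_def)

lemma edist_pos:
  assumes "x \<in> Rn n" "y \<in> Rn n" "x \<noteq> y"
  shows "0 < edist n x y"
proof -
  have "edist n x y \<noteq> 0"
  proof
    assume "edist n x y = 0"
    hence "\<forall>i<n. x i = y i" by (simp add: edist_def nrm_def L2_set_eq_0_iff)
    thus False using assms PiE_ext[of x "{..<n}" "\<lambda>_. UNIV" y] by auto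
  qed
  thus ?thesis using edist_nonneg[of n x y] by simp
qed

text \<open>This symmetrisation turns the one-sided inner products of the exchangeable pair into a
  squared distance.\<close>

lemma edist_squared: "(edist n x y)\<^sup>2 = ip n (\<lambda>i. x i - y i) x + ip n (\<lambda>i. y i - x i) y"
proof -
  have "(edist n x y)\<^sup>2 = (\<Sum>i<n. (x i - y i)\<^sup>2)"
    by (simp add: edist_def nrm_def L2_set_def sum_nonneg)
  thus ?thesis by (simp add: ip_def sum.distrib[symmetric] power2_eq_square algebra_simps)
qed

section \<open>Support functions and their measurability\<close>

definition support :: "nat \<Rightarrow> (nat \<Rightarrow> real) set \<Rightarrow> (nat \<Rightarrow> real) \<Rightarrow> real" where
  "support n A x = (SUP t\<in>A. ip n x t)"

lemma bdd_support: "(\<And>t. t \<in> A \<Longrightarrow> nrm n t \<le> R) \<Longrightarrow> bdd_above (ip n x ` A)"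
  by (rule bdd_aboveI[of _ "nrm n x * R"])
     (auto intro!: order.trans[OF order.trans[OF abs_ge_self abs_ip_le]] mult_left_mono nrm_nonneg)

lemma support_ge: "(\<And>t. t \<in> A \<Longrightarrow> nrm n t \<le> R) \<Longrightarrow> t \<in> A \<Longrightarrow> ip n x t \<le> support n A x"
  unfolding support_def by (intro cSUP_upper bdd_support)

lemma support_le: "A \<noteq> {} \<Longrightarrow> (\<And>t. t \<in> A \<Longrightarrow> ip n x t \<le> c) \<Longrightarrow> support n A x \<le> c"
  unfolding support_def by (intro cSUP_least)

lemma support_mono: 
  "A \<noteq> {} \<Longrightarrow> A \<subseteq> B \<Longrightarrow> (\<And>t. t \<in> B \<Longrightarrow> nrm n t \<le> R) \<Longrightarrow> support n A x \<le> support n B x"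
  by (intro support_le support_ge) auto

lemma abs_support_le:
  assumes "A \<noteq> {}" "\<And>t. t \<in> A \<Longrightarrow> nrm n t \<le> R"
  shows "\<bar>support n A x\<bar> \<le> nrm n x * R"
proof -
  have le: "\<bar>ip n x t\<bar> \<le> nrm n x * R" if "t \<in> A" for t
    using order.trans[OF abs_ip_le mult_left_mono[OF assms(2)[OF that] nrm_nonneg]] .
  obtain t where t: "t \<in> A" using assms(1) by auto
  have "ip n x t \<le> support n A x" using assms(2) t by (rule support_ge)
  moreover have "support n A x \<le> nrm n x * R" 
    using le assms(1) by (intro support_le) (auto simp: abs_le_iff)
  ultimately show ?thesis using le[OF t] by linarith
qed

lemma support_cong: "(\<And>i. i < n \<Longrightarrow> x i = y i) \<Longrightarrow> support n A x = support n A y"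
  unfolding support_def ip_def by (intro SUP_cong refl sum.cong) auto

lemma measurable_ip_shift [measurable]: 
  "(\<lambda>x. ip n (\<lambda>i. x i - c i) t) \<in> borel_measurable (borel_Rn n)"
  unfolding ip_def by measurable

text \<open>\<open>ip n x\<close> is continuous for the product topology, so a countable dense
  subset of \<open>A\<close> gives the same supremum.\<close>

lemma measurable_support_shift:
  assumes A: "A \<noteq> {}" "\<And>t. t \<in> A \<Longrightarrow> nrm n t \<le> R"
  shows "(\<lambda>x. support n A (\<lambda>i. x i - c i)) \<in> borel_measurable (borel_Rn n)"
proof -
  obtain D where D: "countable D" "D \<subseteq> A" "A \<subseteq> closure D" using separable[of A] by blast
  have Dne: "D \<noteq> {}" using D A(1) by auto
  have bddA: "bdd_above (ip n x ` A)" for x using A(2) by (rule bdd_support)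
  have bddD: "bdd_above (ip n x ` D)" for x 
    using bdd_above_mono[OF bddA[of x], of "ip n x ` D"] D(2) by (simp add: image_mono)
  have "support n A x = (SUP t\<in>D. ip n x t)" for x
  proof (rule antisym)
    have cont: "continuous_on UNIV (ip n x)"
      unfolding ip_def by (intro continuous_intros continuous_on_product_coordinates)
    have "closed {t. ip n x t \<le> (SUP t\<in>D. ip n x t)}"
      by (intro closed_Collect_le cont continuous_on_const)
    moreover have "D \<subseteq> {t. ip n x t \<le> (SUP t\<in>D. ip n x t)}"
      using bddD by (auto intro: cSUP_upper)
    ultimately have "A \<subseteq> {t. ip n x t \<le> (SUP t\<in>D. ip n x t)}"
      using D(3) closure_minimal by blast
    thus "support n A x \<le> (SUP t\<in>D. ip n x t)" using A(1) by (intro support_le) auto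
    show "(SUP t\<in>D. ip n x t) \<le> support n A x"
      unfolding support_def using Dne bddA D(2) by (intro cSUP_subset_mono) auto
  qed
  thus ?thesis using D(1) bddD by simp
qed

section \<open>Growth of the expected supremum\<close>

text \<open>\<open>C\<close> may be any positive bound, which leaves room for a supremum that is not
  itself positive.\<close>

locale kl_lipschitz = prob_space \<mu> for \<mu> :: "(nat \<Rightarrow> real) measure" +
  fixes n :: nat and C :: real
  assumes sets_mu: "sets \<mu> = sets (borel_Rn n)"
    and cent: "centered n \<mu>"
    and C_pos: "0 < C"
    and KL_le: "\<And>\<theta> \<eta>. \<theta> \<in> Rn n \<Longrightarrow> \<eta> \<in> Rn n \<Longrightarrow> \<theta> \<noteq> \<eta> \<Longrightarrow>
        KL (translate n \<mu> \<theta>) (translate n \<mu> \<eta>) \<le> ereal (C * (edist n \<theta> \<eta>)\<^sup>2)"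
begin

section \<open>Laws of translates\<close>

lemma measurable_mu: "f \<in> borel_measurable (borel_Rn n) \<Longrightarrow> f \<in> borel_measurable \<mu>"
  unfolding measurable_cong_sets[OF sets_mu refl] .

lemma measurable_shift [measurable]: "(\<lambda>x. \<lambda>i\<in>{..<n}. \<theta> i + x i) \<in> measurable \<mu> (borel_Rn n)"
  unfolding measurable_cong_sets[OF sets_mu refl] by measurable

lemma prob_translate: "prob_space (translate n \<mu> \<theta>)"
  unfolding translate_def by (intro prob_space_distr measurable_shift)

lemma sets_translate [simp]: "sets (translate n \<mu> \<theta>) = sets (borel_Rn n)"
  by (simp add: translate_def)

text \<open>Equal translates are not covered by \<open>KL_le\<close>; for them
  \<open>1 + h \<le> exp h\<close> suffices. The case arises because the centre may belong to the
  separated set.\<close>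

lemma translate_variational:
  assumes "\<theta> \<in> Rn n" "\<eta> \<in> Rn n" "h \<in> borel_measurable (borel_Rn n)" and B: "\<And>x. \<bar>h x\<bar> \<le> B"
  shows "(\<integral>x. h x \<partial>translate n \<mu> \<theta>) \<le> C * (edist n \<theta> \<eta>)\<^sup>2 - 1 + (\<integral>x. exp (h x) \<partial>translate n \<mu> \<eta>)"
proof (cases "\<theta> = \<eta>")
  case True
  interpret P: prob_space "translate n \<mu> \<eta>" by (rule prob_translate)
  have h[measurable]: "h \<in> borel_measurable (translate n \<mu> \<eta>)"
    using assms(3) unfolding measurable_cong_sets[OF sets_translate refl] .
  have eint: "integrable (translate n \<mu> \<eta>) (\<lambda>x. exp (h x))"
    using B by (intro P.integrable_const_bound[of _ "exp B"]) (auto intro: order.trans[OF abs_ge_self])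
  have "(\<integral>x. h x \<partial>translate n \<mu> \<eta>) \<le> (\<integral>x. exp (h x) - 1 \<partial>translate n \<mu> \<eta>)"
  proof (rule integral_mono)
    show "integrable (translate n \<mu> \<eta>) h"
      using B by (intro P.integrable_const_bound[of _ B]) auto
    show "integrable (translate n \<mu> \<eta>) (\<lambda>x. exp (h x) - 1)" using eint by simp
    show "h x \<le> exp (h x) - 1" for x using exp_ge_add_one_self[of "h x"] by linarith
  qed
  also have "\<dots> = (\<integral>x. exp (h x) \<partial>translate n \<mu> \<eta>) - 1" using eint by (simp add: P.prob_space)
  finally show ?thesis by (simp add: True edist_refl)
next
  case False
  have h: "h \<in> borel_measurable (translate n \<mu> \<eta>)"
    using assms(3) unfolding measurable_cong_sets[OF sets_translate refl] .
  show ?thesis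
    by (rule KL_variational(2)[OF prob_translate prob_translate _ KL_le[OF assms(1,2) False] h B]) simp_all
qed

lemma absolutely_continuous_translate:
  assumes "\<theta> \<in> Rn n" "\<eta> \<in> Rn n"
  shows "absolutely_continuous (translate n \<mu> \<eta>) (translate n \<mu> \<theta>)"
proof (cases "\<theta> = \<eta>")
  case False
  thus ?thesis using KL_le[OF assms False] by (auto simp: KL_def split: if_splits)
qed (simp add: absolutely_continuous_def)

section \<open>Centering and the expected supremum\<close>

lemma integrable_coordinate: "i < n \<Longrightarrow> integrable \<mu> (\<lambda>x. x i)"
  and integral_coordinate: "i < n \<Longrightarrow> (\<integral>x. x i \<partial>\<mu>) = 0"
  using cent by (auto simp: centered_def)

lemma integral_ip: "integrable \<mu> (\<lambda>x. ip n x t)" "(\<integral>x. ip n x t \<partial>\<mu>) = 0"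
proof -
  have int: "integrable \<mu> (\<lambda>x. x i * t i)" if "i \<in> {..<n}" for i
    using integrable_coordinate that by simp
  show "integrable \<mu> (\<lambda>x. ip n x t)"
    unfolding ip_def using int by (rule Bochner_Integration.integrable_sum)
  show "(\<integral>x. ip n x t \<partial>\<mu>) = 0"
    unfolding ip_def using integral_coordinate
    by (subst Bochner_Integration.integral_sum[OF int]) auto
qed

text \<open>The supremum is dominated by \<open>R\<close> times the sum of the absolute
  coordinates.\<close>

lemma integrable_support:
  assumes A: "A \<noteq> {}" "\<And>t. t \<in> A \<Longrightarrow> nrm n t \<le> R"
  shows "integrable \<mu> (support n A)"
proof (rule Bochner_Integration.integrable_bound)
  show "integrable \<mu> (\<lambda>x. (\<Sum>i<n. \<bar>x i\<bar>) * R)"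
    using integrable_coordinate
    by (intro integrable_mult_left Bochner_Integration.integrable_sum integrable_abs) auto
  show "support n A \<in> borel_measurable \<mu>"
    using measurable_mu[OF measurable_support_shift[OF A, of "\<lambda>_. 0"]] by simp
  have "0 \<le> R" using A nrm_nonneg order.trans by blast
  hence "\<bar>support n A x\<bar> \<le> (\<Sum>i<n. \<bar>x i\<bar>) * R" for x
    unfolding nrm_def
    by (intro order.trans[OF abs_support_le[OF A]] mult_right_mono) (auto simp: nrm_def L2_set_le_sum_abs)
  thus "AE x in \<mu>. norm (support n A x) \<le> norm ((\<Sum>i<n. \<bar>x i\<bar>) * R)"
    by (auto intro: order.trans[OF _ abs_ge_self])
qed

definition width :: "(nat \<Rightarrow> real) set \<Rightarrow> real" where
  "width A = (\<integral>x. support n A x \<partial>\<mu>)"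

text \<open>A single \<open>t\<close> in \<open>A\<close> gives a lower bound of mean zero, as
  \<open>\<mu>\<close> is centered.\<close>

lemma width_nonneg:
  assumes "A \<noteq> {}" "\<And>t. t \<in> A \<Longrightarrow> nrm n t \<le> R"
  shows "0 \<le> width A"
proof -
  obtain t where t: "t \<in> A" using assms by auto
  have "(\<integral>x. ip n x t \<partial>\<mu>) \<le> width A"
    unfolding width_def using assms t by (intro integral_mono integral_ip integrable_support support_ge)
  thus ?thesis by (simp add: integral_ip)
qed

lemma width_mono:
  assumes "A \<noteq> {}" "A \<subseteq> B" "\<And>t. t \<in> B \<Longrightarrow> nrm n t \<le> R"
  shows "width A \<le> width B"
proof -
  have *: "nrm n t \<le> R" if "t \<in> A" for t using that assms by blast
  have "B \<noteq> {}" using assms by auto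
  thus ?thesis unfolding width_def 
    using assms * by (intro integral_mono integrable_support support_mono) 
qed

text \<open>Subtracting the shift restores the law \<open>\<mu>\<close>. The shift \<open>c\<close>
  is separate from \<open>\<theta>\<close> because it only has to agree with it on the first
  \<open>n\<close> coordinates.\<close>

lemma integral_support_translate:
  assumes A: "A \<noteq> {}" "\<And>t. t \<in> A \<Longrightarrow> nrm n t \<le> R" and \<theta>: "\<And>i. i < n \<Longrightarrow> \<theta> i = c i"
  shows "integrable (translate n \<mu> \<theta>) (\<lambda>y. support n A (\<lambda>i. y i - c i))"
    "(\<integral>y. support n A (\<lambda>i. y i - c i) \<partial>translate n \<mu> \<theta>) = width A"
proof -
  have *: "(\<lambda>x. support n A (\<lambda>i. (\<lambda>i\<in>{..<n}. \<theta> i + x i) i - c i)) = support n A"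
    by (intro ext support_cong) (auto simp: \<theta>)
  have meas: "(\<lambda>x. support n A (\<lambda>i. x i - c i)) \<in> borel_measurable (borel_Rn n)"
    by (rule measurable_support_shift[OF A])
  show "integrable (translate n \<mu> \<theta>) (\<lambda>y. support n A (\<lambda>i. y i - c i))"
    unfolding translate_def integrable_distr_eq[OF measurable_shift meas] *
    by (rule integrable_support[OF A])
  show "(\<integral>y. support n A (\<lambda>i. y i - c i) \<partial>translate n \<mu> \<theta>) = width A"
    unfolding translate_def width_def integral_distr[OF measurable_shift meas] * ..
qed

section \<open>The multi-scale Sudakov inequality\<close>

text \<open>For \<open>v\<close> in \<open>H\<close> the inner product of \<open>y - l t\<close>
  with \<open>v\<close> is that of \<open>y - l u\<close> plus \<open>l\<close> times that of
  \<open>u - t\<close>. Replacing \<open>v\<close> by \<open>u\<close> in the last term costs at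
  most \<open>l * (2 * R * h)\<close> by Cauchy-Schwarz. In the application \<open>t\<close> is the
  hidden index and \<open>u\<close> the fresh sample.\<close>

lemma support_shift_ge:
  assumes U: "\<And>v. v \<in> U \<Longrightarrow> nrm n v \<le> r" and H: "H \<noteq> {}" "H \<subseteq> U" "\<And>v. v \<in> H \<Longrightarrow> edist n v u \<le> h"
    and R: "edist n t u \<le> 2 * R" and l: "0 \<le> l"
  shows "support n H (\<lambda>i. y i - l * u i) + l * ip n (\<lambda>i. u i - t i) u - l * (2 * R * h)
     \<le> support n U (\<lambda>i. y i - l * t i)"
proof -
  have "ip n (\<lambda>i. y i - l * u i) v \<le> support n U (\<lambda>i. y i - l * t i) - l * ip n (\<lambda>i. u i - t i) u + l * (2 * R * h)"
    if v: "v \<in> H" for v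
  proof -
    have "\<bar>ip n (\<lambda>i. u i - t i) (\<lambda>i. v i - u i)\<bar> \<le> edist n t u * edist n v u"
      using abs_ip_le[of n "\<lambda>i. u i - t i" "\<lambda>i. v i - u i"] edist_sym[of n t u] by (simp add: edist_def)
    also have "\<dots> \<le> 2 * R * h"
      using R H(3)[OF v] edist_nonneg[of n t u] edist_nonneg[of n v u] by (intro mult_mono) auto
    finally have "ip n (\<lambda>i. u i - t i) u - 2 * R * h \<le> ip n (\<lambda>i. u i - t i) v"
      by (simp add: ip_diff_right abs_le_iff)
    hence "l * (ip n (\<lambda>i. u i - t i) u - 2 * R * h) \<le> l * ip n (\<lambda>i. u i - t i) v"
      using l by (intro mult_left_mono)
    moreover have "ip n (\<lambda>i. y i - l * t i) v = ip n (\<lambda>i. y i - l * u i) v + l * ip n (\<lambda>i. u i - t i) v"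
      by (simp add: ip_diff_left ip_scale_left algebra_simps)
    moreover have "ip n (\<lambda>i. y i - l * t i) v \<le> support n U (\<lambda>i. y i - l * t i)"
      using U v H(2) by (intro support_ge) auto
    ultimately show ?thesis by (simp add: algebra_simps)
  qed
  hence "support n H (\<lambda>i. y i - l * u i) \<le> support n U (\<lambda>i. y i - l * t i) - l * ip n (\<lambda>i. u i - t i) u + l * (2 * R * h)"
    using H(1) by (intro support_le)
  thus ?thesis by simp
qed

text \<open>\<open>weighted_pairing\<close> is applied to the densities \<open>f t x\<close> at each
  observation \<open>x\<close> and integrated over \<open>Q\<close>; by
  \<open>posterior_collision_le\<close> at least a quarter of the mass lies off the
  diagonal.\<close>

lemma width_growth_sum:
  assumes I: "finite I" "2 \<le> card I" and R: "0 < R" "\<And>u. u \<in> I \<Longrightarrow> edist n u s \<le> R"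
    and sep: "0 < \<epsilon>" "\<And>u v. u \<in> I \<Longrightarrow> v \<in> I \<Longrightarrow> u \<noteq> v \<Longrightarrow> \<epsilon> \<le> edist n u v"
    and H: "\<And>u. u \<in> I \<Longrightarrow> H u \<noteq> {}" "\<And>u v. u \<in> I \<Longrightarrow> v \<in> H u \<Longrightarrow> nrm n v \<le> r"
       "\<And>u v. u \<in> I \<Longrightarrow> v \<in> H u \<Longrightarrow> edist n v u \<le> h"
    and l: "0 \<le> l" "C * (l * R)\<^sup>2 \<le> ln (card I) / 12"
  shows "(\<Sum>u\<in>I. width (H u)) + real (card I) * l * (\<epsilon>\<^sup>2 / 8 - 2 * R * h) \<le> card I * width (\<Union>u\<in>I. H u)"
proof -
  define \<theta> where "\<theta> t = (\<lambda>i\<in>{..<n}. l * t i)" for t :: "nat \<Rightarrow> real"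
  define P where "P t = translate n \<mu> (\<theta> t)" for t
  \<comment> \<open>The translate by the centre is the reference measure: all of \<open>I\<close>
    lies within \<open>R\<close> of \<open>s\<close>, so each divergence is at most
    \<open>C * (l * R)\<^sup>2\<close>.\<close>
  define Q where "Q = translate n \<mu> (\<theta> s)"
  define f where "f t = (\<lambda>x. enn2real (RN_deriv Q (P t) x))" for t
  define S where "S x = (\<Sum>t\<in>I. f t x)" for x
  define p where "p t x = f t x / S x" for t x
  define U where "U = (\<Union>u\<in>I. H u)"
  define a where "a t x = support n U (\<lambda>i. x i - l * t i)" for t x
  define b where "b t x = support n (H t) (\<lambda>i. x i - l * t i)" for t x
  define e where "e = l * (2 * R * h)"
  have \<theta>: "\<theta> t \<in> Rn n" "\<And>i. i < n \<Longrightarrow> \<theta> t i = l * t i" for t by (auto simp: \<theta>_def)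
  have ed: "edist n (\<theta> t) (\<theta> s) = l * edist n t s" for t
  proof -
    have "edist n (\<theta> t) (\<theta> s) = L2_set (\<lambda>i. l * (t i - s i)) {..<n}"
      unfolding edist_def nrm_def by (intro L2_set_cong) (auto simp: \<theta>_def algebra_simps)
    thus ?thesis using l by (simp add: L2_set_right_distrib edist_def nrm_def)
  qed
  interpret Q: prob_space Q unfolding Q_def by (rule prob_translate)
  have PP: "prob_space (P t)" and sP: "sets (P t) = sets Q" for t
    by (simp_all add: P_def Q_def prob_translate)
  have ac: "absolutely_continuous Q (P t)" for t 
    unfolding P_def Q_def by (intro absolutely_continuous_translate \<theta>)
  have sQ: "sets Q = sets (borel_Rn n)" by (simp add: Q_def)
  have fm[measurable]: "f t \<in> borel_measurable Q" for t unfolding f_def by measurable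
  have f0: "0 \<le> f t x" for t x by (simp add: f_def)
  have dens: "density Q (\<lambda>x. ennreal (f t x)) = P t" for t
    unfolding f_def by (rule density_enn2real_RN_deriv[OF PP Q.prob_space_axioms ac sP])
  have Sm[measurable]: "S \<in> borel_measurable Q" unfolding S_def by measurable
  have pm[measurable]: "p t \<in> borel_measurable Q" for t unfolding p_def by measurable
  have S0: "0 \<le> S x" for x unfolding S_def by (intro sum_nonneg f0)
  have p0: "0 \<le> p t x" for t x unfolding p_def by (intro divide_nonneg_nonneg f0 S0)
  \<comment> \<open>Where \<open>S x = 0\<close>, division makes all \<open>p t x\<close> zero,
    hence an inequality.\<close>
  have psum: "(\<Sum>t\<in>I. p t x) \<le> 1" for x
    unfolding p_def sum_divide_distrib[symmetric] by (simp add: S_def divide_le_eq_1)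
  have p1: "p t x \<le> 1" if "t \<in> I" for t x
    using member_le_sum[OF that, of "\<lambda>t. p t x"] psum[of x] p0 I(1) by fastforce
  have Une: "U \<noteq> {}" using I H(1) by (fastforce simp: U_def)
  have Ub: "nrm n v \<le> r" if "v \<in> U" for v using that H(2) by (auto simp: U_def)
  have toQ: "integrable Q (\<lambda>x. f t x * g x)" "(\<integral>x. f t x * g x \<partial>Q) = (\<integral>x. g x \<partial>P t)"
    if "integrable (P t) g" for g :: "_ \<Rightarrow> real" and t
  proof -
    have g: "g \<in> borel_measurable Q" 
      using that measurable_cong_sets[OF sP refl, of t borel] by (auto dest: borel_measurable_integrable)
    show "integrable Q (\<lambda>x. f t x * g x)"
      using integrable_real_density[OF fm _ g] f0 that dens by simp
    show "(\<integral>x. f t x * g x \<partial>Q) = (\<integral>x. g x \<partial>P t)"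
      using integral_real_density[OF fm _ g] f0 dens by simp
  qed
  have aP: "integrable (P t) (a t)" "(\<integral>x. a t x \<partial>P t) = width U" for t
    unfolding P_def a_def using integral_support_translate[OF Une Ub \<theta>(2)] by simp_all
  have bP: "integrable (P t) (b t)" "(\<integral>x. b t x \<partial>P t) = width (H t)" if "t \<in> I" for t
    unfolding P_def b_def using integral_support_translate[OF H(1)[OF that] H(2)[OF that] \<theta>(2)] by simp_all
  have pP: "integrable (P t) (p t)" if "t \<in> I" for t
  proof -
    interpret Pt: prob_space "P t" by (rule PP)
    have "p t \<in> borel_measurable (P t)" using pm unfolding measurable_cong_sets[OF sP refl] .
    thus ?thesis using p0 p1[OF that] by (intro Pt.integrable_const_bound[of _ 1]) auto
  qed
  have oneP: "integrable (P t) (\<lambda>_. 1::real)" "(\<integral>x. (1::real) \<partial>P t) = 1" for t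
  proof -
    interpret Pt: prob_space "P t" by (rule PP)
    show "integrable (P t) (\<lambda>_. 1::real)" "(\<integral>x. (1::real) \<partial>P t) = 1" by (simp_all add: Pt.prob_space)
  qed
  have fQ: "integrable Q (f t)" "(\<integral>x. f t x \<partial>Q) = 1" for t
    using toQ[OF oneP(1)] oneP(2) by simp_all
  have SQ: "integrable Q S" "(\<integral>x. S x \<partial>Q) = card I"
    unfolding S_def using fQ by simp_all
  have collision: "(\<Sum>t\<in>I. \<integral>x. p t x \<partial>P t) \<le> 3 / 4 * card I"
  proof (rule posterior_collision_le[OF I Q.prob_space_axioms PP sP _ l(2) pm p0 p1 psum])
    fix t and g :: "(nat \<Rightarrow> real) \<Rightarrow> real" and B assume t: "t \<in> I" and g: "g \<in> borel_measurable Q" "\<And>x. \<bar>g x\<bar> \<le> B"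
    have "g \<in> borel_measurable (borel_Rn n)" using g(1) unfolding measurable_cong_sets[OF sQ refl] .
    hence "(\<integral>x. g x \<partial>P t) \<le> C * (edist n (\<theta> t) (\<theta> s))\<^sup>2 - 1 + (\<integral>x. exp (g x) \<partial>Q)"
      unfolding P_def Q_def using g(2) by (intro translate_variational \<theta>)
    also have "C * (edist n (\<theta> t) (\<theta> s))\<^sup>2 \<le> C * (l * R)\<^sup>2"
      unfolding ed using C_pos l R t by (intro mult_left_mono power_mono) (auto simp: edist_nonneg)
    finally show "(\<integral>x. g x \<partial>P t) \<le> C * (l * R)\<^sup>2 - 1 + (\<integral>x. exp (g x) \<partial>Q)" by simp
  qed
  have pointwise: "(\<Sum>t\<in>I. f t x * b t x) + l * \<epsilon>\<^sup>2 / 2 * (S x - (\<Sum>t\<in>I. f t x * p t x)) - e * S x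
      \<le> (\<Sum>t\<in>I. f t x * a t x)" for x
    unfolding S_def p_def
  proof (rule weighted_pairing[OF I(1) f0 l(1), where q = "\<lambda>t u. ip n (\<lambda>i. u i - t i) u"])
    fix t u assume tu: "t \<in> I" "u \<in> I"
    have "edist n t u \<le> 2 * R" 
      using edist_triangle[of n t u s] edist_sym[of n s u] R(2)[OF tu(1)] R(2)[OF tu(2)] by simp
    thus "b u x + l * ip n (\<lambda>i. u i - t i) u - e \<le> a t x"
      unfolding a_def b_def e_def using tu H l Ub by (intro support_shift_ge) (auto simp: U_def)
    have "ip n (\<lambda>i. u i - t i) u + ip n (\<lambda>i. t i - u i) t = (edist n t u)\<^sup>2"
      by (simp add: edist_squared)
    thus "(if t = u then 0 else \<epsilon>\<^sup>2) \<le> ip n (\<lambda>i. u i - t i) u + ip n (\<lambda>i. t i - u i) t"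
      using sep(2)[OF tu] sep(1) by (auto intro!: power_mono)
  qed
  \<comment> \<open>The quarter of off-diagonal mass turns \<open>\<epsilon>\<^sup>2 / 2\<close>
    into \<open>\<epsilon>\<^sup>2 / 8\<close>.\<close>
  have "(\<Sum>u\<in>I. width (H u)) + real (card I) * l * (\<epsilon>\<^sup>2 / 8 - 2 * R * h)
      = (\<Sum>u\<in>I. width (H u)) + l * \<epsilon>\<^sup>2 / 2 * (card I - 3 / 4 * card I) - e * card I"
    by (simp add: e_def algebra_simps)
  also have "\<dots> \<le> (\<Sum>u\<in>I. width (H u)) + l * \<epsilon>\<^sup>2 / 2 * (card I - (\<Sum>t\<in>I. \<integral>x. p t x \<partial>P t)) - e * card I"
    using collision l by (intro diff_right_mono add_left_mono mult_left_mono diff_left_mono) auto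
  also have "\<dots> = (\<integral>x. (\<Sum>t\<in>I. f t x * b t x) + l * \<epsilon>\<^sup>2 / 2 * (S x - (\<Sum>t\<in>I. f t x * p t x)) - e * S x \<partial>Q)"
    using SQ toQ[OF bP(1)] toQ[OF pP] bP(2) by simp
  also have "\<dots> \<le> (\<integral>x. (\<Sum>t\<in>I. f t x * a t x) \<partial>Q)"
    using SQ toQ[OF bP(1)] toQ[OF pP] toQ[OF aP(1)] by (intro integral_mono pointwise) simp_all
  also have "\<dots> = card I * width U"
    using toQ[OF aP(1)] aP(2) by simp
  finally show ?thesis by (simp add: U_def)
qed

text \<open>The least \<open>width (H u)\<close> is at most the average. The scale \<open>l\<close>
  attains equality in \<open>C * (l * R)\<^sup>2 \<le> ln (card I) / 12\<close>, and the bound on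
  \<open>h * R\<close> leaves at least half of \<open>\<epsilon>\<^sup>2 / 8\<close>.\<close>

lemma width_growth:
  assumes I: "finite I" "2 \<le> card I" and R: "0 < R" "\<And>u. u \<in> I \<Longrightarrow> edist n u s \<le> R"
    and sep: "0 < \<epsilon>" "\<And>u v. u \<in> I \<Longrightarrow> v \<in> I \<Longrightarrow> u \<noteq> v \<Longrightarrow> \<epsilon> \<le> edist n u v"
    and H: "\<And>u. u \<in> I \<Longrightarrow> H u \<noteq> {}" "\<And>u v. u \<in> I \<Longrightarrow> v \<in> H u \<Longrightarrow> nrm n v \<le> r"
       "\<And>u v. u \<in> I \<Longrightarrow> v \<in> H u \<Longrightarrow> edist n v u \<le> h"
    and h: "h * R \<le> \<epsilon>\<^sup>2 / 32"
  shows "\<exists>u\<in>I. width (H u) + 1 / (16 * sqrt (12 * C)) * sqrt (ln (card I)) * \<epsilon>\<^sup>2 / R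
     \<le> width (\<Union>u\<in>I. H u)"
proof (rule ccontr)
  define l where "l = sqrt (ln (card I)) / (sqrt (12 * C) * R)"
  have ln0: "0 \<le> ln (real (card I))" using I by simp
  have l0: "0 \<le> l" using ln0 C_pos R by (simp add: l_def)
  have "C * (l * R)\<^sup>2 = ln (card I) / 12"
    using ln0 C_pos R by (simp add: l_def power_divide power_mult_distrib)
  hence sum: "(\<Sum>u\<in>I. width (H u)) + real (card I) * l * (\<epsilon>\<^sup>2 / 8 - 2 * R * h) \<le> card I * width (\<Union>u\<in>I. H u)"
    by (intro width_growth_sum[OF I R sep H l0]) auto
  have gain: "1 / (16 * sqrt (12 * C)) * sqrt (ln (card I)) * \<epsilon>\<^sup>2 / R = l * (\<epsilon>\<^sup>2 / 16)"
    by (simp add: l_def)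
  assume "\<not> ?thesis"
  hence "width (\<Union>u\<in>I. H u) < width (H u) + l * (\<epsilon>\<^sup>2 / 16)" if "u \<in> I" for u
    using that unfolding gain by force
  moreover have "I \<noteq> {}" using I by auto
  ultimately have "(\<Sum>u\<in>I. width (\<Union>u\<in>I. H u)) < (\<Sum>u\<in>I. width (H u) + l * (\<epsilon>\<^sup>2 / 16))"
    using I(1) by (intro sum_strict_mono)
  hence "card I * width (\<Union>u\<in>I. H u) < (\<Sum>u\<in>I. width (H u)) + card I * l * (\<epsilon>\<^sup>2 / 16)"
    by (simp add: sum.distrib)
  also have "card I * l * (\<epsilon>\<^sup>2 / 16) \<le> card I * l * (\<epsilon>\<^sup>2 / 8 - 2 * R * h)"
    using h l0 by (intro mult_left_mono) (auto simp: mult_ac)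
  finally show False using sum by simp
qed

section \<open>Conclusion for \<open>gamma2\<close>\<close>

lemma gamma2_le_width:
  assumes T: "T \<noteq> {}" "\<And>t. t \<in> T \<Longrightarrow> nrm n t \<le> r"
  shows "gamma2 T (edist n) \<le> ennreal (128 * 10 ^ 7 * sqrt C * width T)"
proof -
  let ?\<kappa> = "1 / (16 * sqrt (12 * C))"
  have sub: "nrm n t \<le> r" if "A \<subseteq> T" "t \<in> A" for A t using that T(2) by blast
  interpret G: growth_functional T "edist n" width ?\<kappa> "r + r"
  proof
    show "edist n x y \<le> r + r" if "x \<in> T" "y \<in> T" for x y
      using edist_le_nrm[of n x y] T(2)[OF that(1)] T(2)[OF that(2)] by simp
    show "0 \<le> width A" if "A \<noteq> {}" "A \<subseteq> T" for A
      by (rule width_nonneg[OF that(1) sub[OF that(2)]])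
    show "width A \<le> width B" if "A \<noteq> {}" "A \<subseteq> B" "B \<subseteq> T" for A B
      by (rule width_mono[OF that(1,2) sub[OF that(3)]])
    show "\<exists>u\<in>I. width (H u) + ?\<kappa> * sqrt (ln (real (card I))) * \<epsilon>\<^sup>2 / R \<le> width (\<Union>u\<in>I. H u)"
      if "finite I" "2 \<le> card I" "0 < R" "0 < \<epsilon>" "\<And>u. u \<in> I \<Longrightarrow> edist n u s \<le> R"
        "\<And>u v. u \<in> I \<Longrightarrow> v \<in> I \<Longrightarrow> u \<noteq> v \<Longrightarrow> \<epsilon> \<le> edist n u v"
        "\<And>u. u \<in> I \<Longrightarrow> H u \<noteq> {}" "\<And>u. u \<in> I \<Longrightarrow> H u \<subseteq> T"
        "\<And>u v. u \<in> I \<Longrightarrow> v \<in> H u \<Longrightarrow> edist n v u \<le> h" "h * R \<le> \<epsilon>\<^sup>2 / 32" for I H s R \<epsilon> h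
      using that(1-3,5,4,6,7) sub[OF that(8)] that(9,10) by (rule width_growth)
  qed (use T C_pos in \<open>auto simp: edist_nonneg edist_refl edist_sym edist_triangle\<close>)
  have W: "0 \<le> width T" using T by (rule width_nonneg)
  \<comment> \<open>These two estimates replace \<open>growth_const\<close> by the explicit multiple
    \<open>1 / 128\<close> of \<open>1 / sqrt C\<close>.\<close>
  have "1 / 2 \<le> sqrt (ln 2)"
    using ln2_ge_two_thirds by (intro real_le_rsqrt) (simp add: power2_eq_square)
  moreover have "sqrt (12 * C) \<le> 4 * sqrt C"
    using real_sqrt_le_mono[of "12 * C" "16 * C"] C_pos by (simp add: real_sqrt_mult)
  ultimately have lower: "1 / (128 * sqrt C) \<le> G.growth_const"
  proof -
    assume 1: "1 / 2 \<le> sqrt (ln 2)" and 2: "sqrt (12 * C) \<le> 4 * sqrt C"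
    have "1 / (128 * sqrt C) = 1 / (16 * (4 * sqrt C)) * (1 / 2)" by simp
    also have "\<dots> \<le> ?\<kappa> * sqrt (ln 2)"
      using 1 2 C_pos by (intro mult_mono divide_left_mono mult_left_mono) auto
    finally show ?thesis by (simp add: G.growth_const_def)
  qed
  have "10 ^ 7 * width T / G.growth_const \<le> 10 ^ 7 * width T / (1 / (128 * sqrt C))"
    using lower W C_pos G.growth_const_pos by (intro divide_left_mono) auto
  also have "\<dots> = 128 * 10 ^ 7 * sqrt C * width T" by simp
  finally show ?thesis by (intro order.trans[OF G.gamma2_le] ennreal_leI)
qed

end

theorem theorem1:
  shows "\<exists>c::real. c > 0 \<and>
    (\<forall>(n::nat) (\<mu> :: (nat \<Rightarrow> real) measure).
       n \<ge> 1 \<longrightarrow> prob_space \<mu> \<longrightarrow> sets \<mu> = sets (borel_Rn n) \<longrightarrow>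
       centered n \<mu> \<longrightarrow> CKL n \<mu> < \<infinity> \<longrightarrow>
       (\<forall>T. T \<noteq> {} \<longrightarrow> T \<subseteq> Rn n \<longrightarrow> (\<exists>R. \<forall>t\<in>T. nrm n t \<le> R) \<longrightarrow>
          ereal (\<integral>x. (SUP t\<in>T. ip n x t) \<partial>\<mu>)
            \<ge> ereal (c / sqrt (real_of_ereal (CKL n \<mu>))) * enn2ereal (gamma2 T (edist n))))"
proof (intro exI[of _ "1 / (128 * 10 ^ 7)"] conjI allI impI)
  fix n :: nat and \<mu> :: "(nat \<Rightarrow> real) measure" and T :: "(nat \<Rightarrow> real) set"
  assume prob: "prob_space \<mu>" and sets: "sets \<mu> = sets (borel_Rn n)" and cent: "centered n \<mu>"
    and fin: "CKL n \<mu> < \<infinity>" and T: "T \<noteq> {}" "T \<subseteq> Rn n" "\<exists>R. \<forall>t\<in>T. nrm n t \<le> R"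
  obtain r where r: "nrm n t \<le> r" if "t \<in> T" for t using T(3) by blast
  define C where "C = real_of_ereal (CKL n \<mu>)"
  \<comment> \<open>The real value \<open>C\<close> may fail to be positive; \<open>C'\<close> is
    positive and still bounds \<open>CKL n \<mu>\<close>.\<close>
  define C' where "C' = (if 0 < C then C else 1)"
  have C': "0 < C'" by (simp add: C'_def)
  have CKL: "CKL n \<mu> \<le> ereal C'"
    using fin by (cases "CKL n \<mu>") (auto simp: C'_def C_def)
  interpret kl_lipschitz \<mu> n C'
  proof (intro kl_lipschitz.intro kl_lipschitz_axioms.intro prob sets cent C')
    fix \<theta> \<eta> assume "\<theta> \<in> Rn n" "\<eta> \<in> Rn n" "\<theta> \<noteq> \<eta>"
    hence d: "0 < (edist n \<theta> \<eta>)\<^sup>2"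
      and "KL (translate n \<mu> \<theta>) (translate n \<mu> \<eta>) / ereal ((edist n \<theta> \<eta>)\<^sup>2) \<le> CKL n \<mu>"
      using edist_pos[of \<theta> n \<eta>] unfolding CKL_def by (auto intro!: SUP_upper2[of "(\<theta>, \<eta>)"])
    hence "KL (translate n \<mu> \<theta>) (translate n \<mu> \<eta>) / ereal ((edist n \<theta> \<eta>)\<^sup>2) \<le> ereal C'"
      using CKL by (blast intro: order.trans)
    thus "KL (translate n \<mu> \<theta>) (translate n \<mu> \<eta>) \<le> ereal (C' * (edist n \<theta> \<eta>)\<^sup>2)"
      using d by (subst (asm) ereal_divide_le_pos) (auto simp: mult.commute)
  qed
  have W: "(\<integral>x. (SUP t\<in>T. ip n x t) \<partial>\<mu>) = width T" by (simp add: width_def support_def)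
  have W0: "0 \<le> width T" using T(1) r by (rule width_nonneg)
  let ?c = "1 / (128 * 10 ^ 7) :: real"
  have "ereal (?c / sqrt C) * enn2ereal (gamma2 T (edist n)) \<le> ereal (width T)"
  proof (cases "0 < C")
    case True
    have "gamma2 T (edist n) \<le> ennreal (128 * 10 ^ 7 * sqrt C * width T)"
      using gamma2_le_width[OF T(1) r] True by (simp add: C'_def)
    hence "enn2ereal (gamma2 T (edist n)) \<le> ereal (128 * 10 ^ 7 * sqrt C * width T)"
      using W0 True by (simp add: less_eq_ennreal.rep_eq enn2ereal_ennreal)
    hence "ereal (?c / sqrt C) * enn2ereal (gamma2 T (edist n)) \<le>
        ereal (?c / sqrt C) * ereal (128 * 10 ^ 7 * sqrt C * width T)"
      using True by (intro ereal_mult_left_mono) auto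
    also have "\<dots> = ereal (width T)" using True by simp
    finally show ?thesis .
  next
    case False
    \<comment> \<open>For \<open>C \<le> 0\<close> also \<open>sqrt C \<le> 0\<close>, and division
      by zero gives zero, so the lower bound is not positive.\<close>
    hence "?c / sqrt C \<le> 0" by (simp add: divide_nonneg_nonpos)
    hence "ereal (?c / sqrt C) * enn2ereal (gamma2 T (edist n)) \<le> 0"
      using ereal_mult_right_mono[of "ereal (?c / sqrt C)" 0 "enn2ereal (gamma2 T (edist n))"] by simp
    also have "0 \<le> ereal (width T)" using W0 by simp
    finally show ?thesis .
  qed
  thus "ereal (?c / sqrt (real_of_ereal (CKL n \<mu>))) * enn2ereal (gamma2 T (edist n))
      \<le> ereal (\<integral>x. (SUP t\<in>T. ip n x t) \<partial>\<mu>)"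
    by (simp only: W C_def)
qed simp

end
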